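(* Let $\nu\in(0,1)$, let $\{S(t):t\geq 0\}$ be a real-valued Lévy process such that $\kappa_S(\theta):=\log\mathbb{E}[e^{\theta S(1)}]$ is finite in a neighborhood of $\theta=0$, and let $\{L_\nu(t):t\geq 0\}$ be an inverse of a stable subordinator of index $\nu$, independent of $\{S(t):t\geq 0\}$. Let $\Lambda_{\nu,S}$ be the function defined by $$\Lambda_{\nu,S}(\theta):=\begin{cases}(\kappa_S(\theta))^{1/\nu} & \text{if } \kappa_S(\theta)\geq 0,\\ 0 & \text{if } \kappa_S(\theta)<0,\end{cases}\qquad \theta\in\mathbb{R},$$ and assume that it is an essentially smooth function. Then $\left\{\frac{S(L_\nu(t))}{t}:t>0\right\}$ satisfies the large deviation principle (as $t\to\infty$) with speed $v_t=t$ and good rate function $I_{\mathrm{LD}}$ defined by $$I_{\mathrm{LD}}(x):=\sup_{\theta\in\mathbb{R}}\{\theta x-\Lambda_{\nu,S}(\theta)\}.$$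
   Context: Inverse of a stable subordinator: for $\nu\in(0,1)$, $L_\nu(t)=\inf\{u\geq 0: H_\nu(u)>t\}$, where $\{H_\nu(u):u\ge 0\}$ is the stable subordinator with $\mathbb{E}[e^{-\xi H_\nu(u)}]=e^{-u\xi^\nu}$ for $\xi\geq 0$. Its moment generating function is $\mathbb{E}[e^{\theta L_\nu(t)}]=E_\nu(\theta t^\nu)$ for all $\theta\in\mathbb{R}$, where $E_\nu(x):=\sum_{k=0}^\infty\frac{x^k}{\Gamma(\nu k+1)}$ is the Mittag-Leffler function. The function $\kappa_S$ takes values in $(-\infty,\infty]$, and $(\kappa_S(\theta))^{1/\nu}=\infty$ when $\kappa_S(\theta)=\infty$. Large deviation principle (LDP): a family of real random variables $\{Z(t):t>0\}$ satisfies the LDP with speed $v_t\to\infty$ and rate function $I:\mathbb{R}\to[0,\infty]$ (lower semicontinuous) if $\limsup_{t\to\infty}\frac{1}{v_t}\log P(Z(t)\in C)\leq-\inf_{x\in C}I(x)$ for all closed sets $C$ and $\liminf_{t\to\infty}\frac{1}{v_t}\log P(Z(t)\in O)\geq-\inf_{x\in O}I(x)$ for all open sets $O$. The rate function $I$ is good if all level sets $\{x\in\mathbb{R}:I(x)\leq b\}$, $b\geq 0$, are compact. Essentially smooth: a function $\Lambda:\mathbb{R}\to(-\infty,\infty]$ with $\mathcal{D}(\Lambda):=\{\theta\in\mathbb{R}:\Lambda(\theta)<\infty\}$ is essentially smooth if the interior of $\mathcal{D}(\Lambda)$ is non-empty, $\Lambda$ is differentiable throughout this interior, and $\Lambda$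 is steep, i.e. $|\Lambda'(\theta_n)|\to\infty$ whenever $(\theta_n)$ is a sequence in the interior of $\mathcal{D}(\Lambda)$ converging to a boundary point of $\mathcal{D}(\Lambda)$. *)

theory Defs
  imports "HOL-Probability.Probability"
begin

section \<open>Levy processes and inverse stable subordinators\<close>

text \<open>
  Processes are indexed by \<^typ>\<open>real\<close>; only nonnegative times are ever constrained.
  Path properties are required almost surely, so functionals of whole paths, such as first
  passage times or a process evaluated at a random time, need only be measurable with respect to
  \<^term>\<open>completion M\<close>.
\<close>

definition cadlag :: "(real \<Rightarrow> real) \<Rightarrow> bool" where
  "cadlag f \<longleftrightarrow>
     (\<forall>t\<ge>0. continuous (at_right t) f) \<and> (\<forall>t>0. \<exists>l. (f \<longlongrightarrow> l) (at_left t))"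

text \<open>Stochastic continuity is implied by right-continuity and stationarity of the increments.\<close>

definition levy_process :: "'a measure \<Rightarrow> (real \<Rightarrow> 'a \<Rightarrow> real) \<Rightarrow> bool" where
  "levy_process M X \<longleftrightarrow>
     prob_space M \<and>
     (\<forall>t\<ge>0. X t \<in> borel_measurable M) \<and>
     (AE \<omega> in M. X 0 \<omega> = 0) \<and>
     (\<forall>(n::nat) (\<tau>::nat \<Rightarrow> real). 0 \<le> \<tau> 0 \<and> (\<forall>i<n. \<tau> i \<le> \<tau> (Suc i)) \<longrightarrow>
        prob_space.indep_vars M (\<lambda>_. borel) (\<lambda>i \<omega>. X (\<tau> (Suc i)) \<omega> - X (\<tau> i) \<omega>) {..<n}) \<and>
     (\<forall>s\<ge>0. \<forall>h\<ge>0. distr M borel (\<lambda>\<omega>. X (s + h) \<omega> - X s \<omega>) =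
                    distr M borel (\<lambda>\<omega>. X h \<omega> - X 0 \<omega>)) \<and>
     (AE \<omega> in M. cadlag (\<lambda>t. X t \<omega>))"

definition stable_subordinator :: "'a measure \<Rightarrow> real \<Rightarrow> (real \<Rightarrow> 'a \<Rightarrow> real) \<Rightarrow> bool" where
  "stable_subordinator M \<nu> H \<longleftrightarrow>
     levy_process M H \<and>
     (AE \<omega> in M. mono_on {0..} (\<lambda>u. H u \<omega>)) \<and>
     (\<forall>u\<ge>0. \<forall>\<xi>\<ge>0. prob_space.expectation M (\<lambda>\<omega>. exp (- \<xi> * H u \<omega>)) = exp (- u * \<xi> powr \<nu>))"

text \<open>
  Almost surely \<open>H u\<close> is unbounded in \<open>u\<close>, so the infimum is taken over a nonempty set that
  is bounded below.
\<close>

definition inverse_stable_subordinator ::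
    "'a measure \<Rightarrow> real \<Rightarrow> (real \<Rightarrow> 'a \<Rightarrow> real) \<Rightarrow> bool" where
  "inverse_stable_subordinator M \<nu> L \<longleftrightarrow>
     (\<exists>H. stable_subordinator M \<nu> H \<and>
          (AE \<omega> in M. \<forall>t\<ge>0. L t \<omega> = Inf {u. 0 \<le> u \<and> H u \<omega> > t}))"

text \<open>Independence of the sigma-algebras generated by the two whole processes.\<close>

definition indep_processes ::
    "'a measure \<Rightarrow> (real \<Rightarrow> 'a \<Rightarrow> real) \<Rightarrow> (real \<Rightarrow> 'a \<Rightarrow> real) \<Rightarrow> bool" where
  "indep_processes M X Y \<longleftrightarrow>
     prob_space.indep_var M
       (Pi\<^sub>M {0..} (\<lambda>_. borel)) (\<lambda>\<omega>. \<lambda>t\<in>{0..}. X t \<omega>)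
       (Pi\<^sub>M {0..} (\<lambda>_. borel)) (\<lambda>\<omega>. \<lambda>t\<in>{0..}. Y t \<omega>)"

section \<open>Logarithmic moment generating functions\<close>

definition ln_ennreal :: "ennreal \<Rightarrow> ereal" where
  "ln_ennreal x = (if x = 0 then -\<infinity> else if x = \<infinity> then \<infinity> else ereal (ln (enn2real x)))"

definition log_mgf :: "'a measure \<Rightarrow> ('a \<Rightarrow> real) \<Rightarrow> real \<Rightarrow> ereal" where
  "log_mgf M X \<theta> = ln_ennreal (\<integral>\<^sup>+\<omega>. ennreal (exp (\<theta> * X \<omega>)) \<partial>M)"

definition Lambda_fun :: "real \<Rightarrow> (real \<Rightarrow> ereal) \<Rightarrow> real \<Rightarrow> ereal" where
  "Lambda_fun \<nu> \<kappa> \<theta> =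
     (if \<kappa> \<theta> \<ge> 0
      then (if \<kappa> \<theta> = \<infinity> then \<infinity> else ereal (real_of_ereal (\<kappa> \<theta>) powr (1 / \<nu>)))
      else 0)"

definition eff_domain :: "(real \<Rightarrow> ereal) \<Rightarrow> real set" where
  "eff_domain \<Lambda> = {\<theta>. \<Lambda> \<theta> < \<infinity>}"

definition essentially_smooth :: "(real \<Rightarrow> ereal) \<Rightarrow> bool" where
  "essentially_smooth \<Lambda> \<longleftrightarrow>
     (\<forall>\<theta>. \<Lambda> \<theta> \<noteq> -\<infinity>) \<and>
     interior (eff_domain \<Lambda>) \<noteq> {} \<and>
     (\<forall>\<theta>\<in>interior (eff_domain \<Lambda>). (\<lambda>x. real_of_ereal (\<Lambda> x)) differentiable at \<theta>) \<and>
     (\<forall>(\<theta>s::nat \<Rightarrow> real) \<theta>.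
        (\<forall>n. \<theta>s n \<in> interior (eff_domain \<Lambda>)) \<and> \<theta> \<in> frontier (eff_domain \<Lambda>) \<and> \<theta>s \<longlonglongrightarrow> \<theta> \<longrightarrow>
        filterlim (\<lambda>n. \<bar>deriv (\<lambda>x. real_of_ereal (\<Lambda> x)) (\<theta>s n)\<bar>) at_top sequentially)"

definition legendre_transform :: "(real \<Rightarrow> ereal) \<Rightarrow> real \<Rightarrow> ereal" where
  "legendre_transform \<Lambda> x = (SUP \<theta>. ereal (\<theta> * x) - \<Lambda> \<theta>)"

section \<open>Large deviations\<close>

text \<open>Lower semicontinuity of \<open>I\<close> is expressed by closedness of its sublevel sets.\<close>

definition satisfies_LDP ::
    "'a measure \<Rightarrow> (real \<Rightarrow> 'a \<Rightarrow> real) \<Rightarrow> (real \<Rightarrow> real) \<Rightarrow> (real \<Rightarrow> ereal) \<Rightarrow> bool" where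
  "satisfies_LDP M Z v I \<longleftrightarrow>
     (\<forall>t>0. Z t \<in> borel_measurable M) \<and>
     filterlim v at_top at_top \<and>
     (\<forall>a. closed {x. I x \<le> a}) \<and>
     (\<forall>x. 0 \<le> I x) \<and>
     (\<forall>C. closed C \<longrightarrow>
        Limsup at_top (\<lambda>t. ereal (1 / v t) * ln_ennreal (emeasure M {\<omega> \<in> space M. Z t \<omega> \<in> C}))
          \<le> - (INF x\<in>C. I x)) \<and>
     (\<forall>U. open U \<longrightarrow>
        Liminf at_top (\<lambda>t. ereal (1 / v t) * ln_ennreal (emeasure M {\<omega> \<in> space M. Z t \<omega> \<in> U}))
          \<ge> - (INF x\<in>U. I x))"

definition good_rate_function :: "(real \<Rightarrow> ereal) \<Rightarrow> bool" where
  "good_rate_function I \<longleftrightarrow> (\<forall>b::real. b \<ge> 0 \<longrightarrow> compact {x. I x \<le> ereal b})"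

end

theory Submission
  imports Defs
begin

text \<open>
  The proof computes the exponential growth rate of the moment generating function of
  \<open>S (L t)\<close> and feeds it into a one-dimensional Gartner-Ellis theorem.

  Conditioning on \<open>L\<close>, which is independent of \<open>S\<close>, turns \<open>E exp (\<theta> S (L t))\<close> into
  \<open>E exp (\<kappa>(\<theta>) L t)\<close> (\<open>levy_mgf\<close> and \<open>nn_integral_process_at_independent_time\<close>).  It remains to
  show that \<open>E exp (k L t)\<close> grows at the rate \<open>k powr (1 / \<nu>)\<close> if \<open>k \<ge> 0\<close>, and at the rate \<open>0\<close> if
  \<open>k < 0\<close> (\<open>inverse_subordinator_mgf_growth\<close>).  Passage times are dual to the subordinator \<open>H\<close>
  whose inverse is \<open>L\<close>: up to boundary cases \<open>L t > u\<close> means \<open>H u \<le> t\<close>.  Hence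
  \<open>P (L t > u) \<le> exp (\<xi> t - u \<xi> powr \<nu>)\<close> for every \<open>\<xi> \<ge> 0\<close>, and for \<open>k \<ge> 0\<close> summing over \<open>u\<close>
  gives a bound of order \<open>exp (\<xi> t)\<close> as soon as \<open>\<xi> powr \<nu> > k\<close>.  Conversely, \<open>L t\<close> reaches the
  level \<open>a t\<close> with probability at least \<open>P (H (a t) \<le> t)\<close>, whose exponential decay is bounded by a
  change of measure from the exact Laplace transform of \<open>H (a t)\<close>; the best \<open>a\<close> gives the matching
  lower bound.  For \<open>k < 0\<close> the rate is \<open>0\<close> because \<open>L t\<close> grows more slowly than \<open>t\<close>.

  The limit \<open>\<Lambda>\<close> is nonnegative with \<open>\<Lambda> 0 = 0\<close>.  Therefore \<open>0\<close> is a minimum, \<open>\<Lambda>\<close> has derivative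
  \<open>0\<close> there, and its Legendre transform \<open>I\<close> vanishes at \<open>0\<close> and is monotone on either side of it.
  This makes the Gartner-Ellis theorem (\<open>gaertner_ellis_nonneg\<close>) short.  For the upper bound a closed
  set that misses \<open>0\<close> is covered by two half-lines, to which the Chernoff bound applies.  For the
  lower bound, exponential tilting handles every point that is a derivative of \<open>\<Lambda>\<close>
  (\<open>exp_growth_slope_lower_bound\<close>), and steepness together with Darboux's theorem shows that such
  points approximate every point of finite rate from the side of \<open>0\<close>, where \<open>I\<close> is not larger
  (\<open>exposed_point_approximation\<close>).
\<close>

section \<open>Exponential growth rates and exponential tilting\<close>

text \<open>
  The integral is taken in \<open>[0, \<infinity>]\<close>, so that an infinite exponential moment keeps its meaning.
\<close>

definition mgf :: "'a measure \<Rightarrow> ('a \<Rightarrow> real) \<Rightarrow> real \<Rightarrow> ennreal" where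
  "mgf M X \<theta> = (\<integral>\<^sup>+\<omega>. ennreal (exp (\<theta> * X \<omega>)) \<partial>M)"

text \<open>
  The convergence of \<open>(1 / t) ln (f t)\<close> to \<open>r\<close>, phrased by two-sided bounds so that no logarithm of
  an extended nonnegative real has to be taken.
\<close>

definition has_exp_growth :: "(real \<Rightarrow> ennreal) \<Rightarrow> real \<Rightarrow> bool" where
  "has_exp_growth f r \<longleftrightarrow>
     (\<forall>c<r. \<forall>\<^sub>F t in at_top. ennreal (exp (c * t)) \<le> f t) \<and>
     (\<forall>c>r. \<forall>\<^sub>F t in at_top. f t \<le> ennreal (exp (c * t)))"

lemma eventually_exp_ge:
  fixes K d :: real
  assumes "0 < d"
  shows "\<forall>\<^sub>F t in at_top. K \<le> exp (d * t)"
proof -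
  have "filterlim (\<lambda>t. exp (d * t)) at_top at_top"
    using assms by (intro filterlim_compose[OF exp_at_top] filterlim_tendsto_pos_mult_at_top[OF tendsto_const]
        filterlim_ident)
  then show ?thesis by (simp add: filterlim_at_top)
qed

lemma has_exp_growth_cong:
  assumes "has_exp_growth g r" "\<And>t. 0 < t \<Longrightarrow> f t = g t"
  shows "has_exp_growth f r"
proof -
  have ev: "\<forall>\<^sub>F t in at_top. f t = g t"
    using eventually_gt_at_top[of 0] by eventually_elim (rule assms(2))
  then have "(\<forall>\<^sub>F t in at_top. a t \<le> f t) = (\<forall>\<^sub>F t in at_top. a t \<le> g t)"
    "(\<forall>\<^sub>F t in at_top. f t \<le> a t) = (\<forall>\<^sub>F t in at_top. g t \<le> a t)" for a
    by (auto elim: eventually_elim2)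
  then show ?thesis using assms(1) by (simp add: has_exp_growth_def)
qed

lemma has_exp_growth_exp: "has_exp_growth (\<lambda>t. ennreal (exp (r * t))) r"
  unfolding has_exp_growth_def
  by (auto intro!: eventually_mono[OF eventually_gt_at_top[of 0]] ennreal_leI mult_right_mono)

lemma chernoff_bound:
  assumes [measurable]: "X \<in> borel_measurable N"
  shows "emeasure N {\<omega> \<in> space N. a \<le> \<theta> * X \<omega>} \<le> ennreal (exp (- a)) * mgf N X \<theta>"
proof -
  let ?E = "{\<omega> \<in> space N. a \<le> \<theta> * X \<omega>}"
  have "emeasure N ?E = (\<integral>\<^sup>+\<omega>. indicator ?E \<omega> \<partial>N)" by simp
  also have "\<dots> \<le> (\<integral>\<^sup>+\<omega>. ennreal (exp (- a)) * ennreal (exp (\<theta> * X \<omega>)) \<partial>N)"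
  proof (rule nn_integral_mono)
    fix \<omega>
    show "indicator ?E \<omega> \<le> ennreal (exp (- a)) * ennreal (exp (\<theta> * X \<omega>))"
      by (cases "\<omega> \<in> ?E")
        (simp_all add: ennreal_mult[symmetric] exp_add[symmetric] ennreal_1[symmetric] del: ennreal_1)
  qed
  also have "\<dots> = ennreal (exp (- a)) * mgf N X \<theta>"
    unfolding mgf_def by (simp add: nn_integral_cmult)
  finally show ?thesis .
qed

lemma half_line_exponential_bound:
  fixes Y :: "real \<Rightarrow> 'a \<Rightarrow> real"
  assumes Y: "\<And>t. 0 < t \<Longrightarrow> Y t \<in> borel_measurable N"
    and growth: "has_exp_growth (\<lambda>t. mgf N (Y t) \<theta>) l"
    and c: "c < \<theta> * x - l"
  shows "\<forall>\<^sub>F t in at_top. emeasure N {\<omega> \<in> space N. \<theta> * x \<le> \<theta> * (Y t \<omega> / t)} \<le> ennreal (exp (- c * t))"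
proof -
  have "\<forall>\<^sub>F t in at_top. mgf N (Y t) \<theta> \<le> ennreal (exp ((\<theta> * x - c) * t))"
  proof -
    have "l < \<theta> * x - c" using c by simp
    then show ?thesis using growth unfolding has_exp_growth_def by blast
  qed
  then show ?thesis using eventually_gt_at_top[of 0]
  proof eventually_elim
    case (elim t)
    have "{\<omega> \<in> space N. \<theta> * x \<le> \<theta> * (Y t \<omega> / t)} = {\<omega> \<in> space N. \<theta> * x * t \<le> \<theta> * Y t \<omega>}"
      using elim by (simp add: pos_le_divide_eq)
    then have "emeasure N {\<omega> \<in> space N. \<theta> * x \<le> \<theta> * (Y t \<omega> / t)} \<le> ennreal (exp (- (\<theta> * x) * t)) * mgf N (Y t) \<theta>"
      using chernoff_bound[OF Y[OF elim(2)], of "\<theta> * x * t" \<theta>] by simp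
    also have "\<dots> \<le> ennreal (exp (- (\<theta> * x) * t)) * ennreal (exp ((\<theta> * x - c) * t))"
      using elim by (intro mult_left_mono) auto
    also have "\<dots> = ennreal (exp (- c * t))"
      by (simp add: ennreal_mult[symmetric] exp_add[symmetric] algebra_simps)
    finally show ?case .
  qed
qed

text \<open>
  Outside the window of radius \<open>\<delta>\<close> around \<open>x\<close>, moving the tilt from \<open>\<eta>\<close> to \<open>\<eta> + h\<close> (to the right
  of the window) or to \<open>\<eta> - h\<close> (to the left) costs at most the displayed prefactor; inside the
  window the exponential is bounded directly.
\<close>

lemma tilted_exponential_bound:
  fixes \<eta> h x \<delta> t y :: real
  assumes "0 < t" "0 \<le> h"
  shows "exp (\<eta> * y) \<le> exp ((\<eta> * x + \<bar>\<eta>\<bar> * \<delta>) * t) * indicator (ball x \<delta>) (y / t)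
           + exp (- (h * (x + \<delta>)) * t) * exp ((\<eta> + h) * y)
           + exp (h * (x - \<delta>) * t) * exp ((\<eta> - h) * y)"
proof -
  consider "y \<ge> (x + \<delta>) * t" | "y \<le> (x - \<delta>) * t" | "y / t \<in> ball x \<delta>"
    using assms(1) by (fastforce simp: dist_real_def field_simps abs_less_iff)
  then show ?thesis
  proof cases
    case 1
    then have "h * ((x + \<delta>) * t) \<le> h * y" using assms by (intro mult_left_mono)
    then have "exp (\<eta> * y) \<le> exp (- (h * (x + \<delta>)) * t) * exp ((\<eta> + h) * y)"
      by (simp add: exp_add[symmetric] algebra_simps)
    then show ?thesis by (simp add: add.assoc add_increasing add_increasing2)
  next
    case 2
    then have "h * y \<le> h * ((x - \<delta>) * t)" using assms by (intro mult_left_mono)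
    then have "exp (\<eta> * y) \<le> exp (h * (x - \<delta>) * t) * exp ((\<eta> - h) * y)"
      by (simp add: exp_add[symmetric] algebra_simps)
    then show ?thesis by (simp add: add.assoc add_increasing add_increasing2)
  next
    case 3
    then have "\<bar>y / t - x\<bar> \<le> \<delta>" by (simp add: dist_real_def abs_minus_commute)
    then have "\<bar>\<eta>\<bar> * \<bar>y / t - x\<bar> \<le> \<bar>\<eta>\<bar> * \<delta>" by (intro mult_left_mono) auto
    then have "\<eta> * (y / t - x) \<le> \<bar>\<eta>\<bar> * \<delta>" using abs_ge_self[of "\<eta> * (y / t - x)"] by (simp add: abs_mult)
    then have "\<eta> * (y / t) \<le> \<eta> * x + \<bar>\<eta>\<bar> * \<delta>" by (simp add: algebra_simps)
    then have "\<eta> * (y / t) * t \<le> (\<eta> * x + \<bar>\<eta>\<bar> * \<delta>) * t"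
      using assms by (intro mult_right_mono) auto
    then have "exp (\<eta> * y) \<le> exp ((\<eta> * x + \<bar>\<eta>\<bar> * \<delta>) * t) * indicator (ball x \<delta>) (y / t)"
      using 3 assms by (simp add: algebra_simps)
    then show ?thesis by (simp add: add_increasing2)
  qed
qed

text \<open>
  The lower bound of Cramer's theorem in its local form.  Under the measure with density proportional
  to \<open>exp (\<eta> Y t)\<close>, the ratio \<open>Y t / t\<close> concentrates at the slope \<open>x\<close> of \<open>\<Lambda>\<close> at \<open>\<eta>\<close>: by
  differentiability, replacing \<open>\<eta>\<close> by \<open>\<eta> + h\<close> raises the growth rate by less than \<open>h (x + \<delta>)\<close>, so
  that values above \<open>x + \<delta>\<close> contribute an exponentially small part of \<open>E exp (\<eta> Y t)\<close>, and
  likewise on the other side.  Hence nearly all of \<open>E exp (\<eta> Y t)\<close> comes from the window, where the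
  integrand is about \<open>exp (\<eta> x t)\<close>.
\<close>

lemma exp_growth_slope_lower_bound:
  fixes \<Lambda> :: "real \<Rightarrow> real" and Y :: "real \<Rightarrow> 'a \<Rightarrow> real"
  assumes "prob_space N"
    and Y: "\<And>t. 0 < t \<Longrightarrow> Y t \<in> borel_measurable N"
    and deriv: "(\<Lambda> has_real_derivative x) (at \<eta>)"
    and growth: "\<forall>\<^sub>F \<theta> in nhds \<eta>. has_exp_growth (\<lambda>t. mgf N (Y t) \<theta>) (\<Lambda> \<theta>)"
    and U: "open U" "x \<in> U"
    and r: "r < \<Lambda> \<eta> - \<eta> * x"
  shows "\<forall>\<^sub>F t in at_top. ennreal (exp (r * t)) \<le> emeasure N {\<omega> \<in> space N. Y t \<omega> / t \<in> U}"
proof -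
  interpret prob_space N by fact
  define g where "g = \<Lambda> \<eta> - \<eta> * x - r"
  have "g > 0" using r by (simp add: g_def)
  obtain \<delta>0 where \<delta>0: "\<delta>0 > 0" "ball x \<delta>0 \<subseteq> U" using U openE by blast
  \<comment> \<open>Half of the available slack \<open>g\<close> pays for the variation of \<open>exp (\<eta> Y t)\<close> over the window.\<close>
  define \<delta> where "\<delta> = min \<delta>0 (g / (2 * (\<bar>\<eta>\<bar> + 1)))"
  have \<delta>: "\<delta> > 0" "ball x \<delta> \<subseteq> U" using \<delta>0 \<open>g > 0\<close> by (auto simp: \<delta>_def)
  have "\<bar>\<eta>\<bar> * \<delta> \<le> \<bar>\<eta>\<bar> * (g / (2 * (\<bar>\<eta>\<bar> + 1)))" by (intro mult_left_mono) (auto simp: \<delta>_def)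
  also have "\<dots> \<le> g / 2" using \<open>g > 0\<close> by (simp add: field_simps)
  finally have \<delta>g: "\<bar>\<eta>\<bar> * \<delta> \<le> g / 2" .
  obtain e0 where e0: "e0 > 0" "\<And>\<theta>. \<bar>\<theta> - \<eta>\<bar> < e0 \<Longrightarrow> has_exp_growth (\<lambda>t. mgf N (Y t) \<theta>) (\<Lambda> \<theta>)"
    using growth unfolding eventually_nhds_metric dist_real_def by blast
  have "((\<lambda>h. (\<Lambda> (\<eta> + h) - \<Lambda> \<eta>) / h) \<longlongrightarrow> x) (at 0)"
    using deriv by (simp add: DERIV_def)
  then have "\<forall>\<^sub>F h in at 0. dist ((\<Lambda> (\<eta> + h) - \<Lambda> \<eta>) / h) x < \<delta>"
    using \<delta>(1) by (rule tendstoD)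
  then obtain e1 where e1: "e1 > 0"
    "\<And>h. h \<noteq> 0 \<Longrightarrow> \<bar>h\<bar> < e1 \<Longrightarrow> \<bar>(\<Lambda> (\<eta> + h) - \<Lambda> \<eta>) / h - x\<bar> < \<delta>"
    by (auto simp: eventually_at dist_real_def)
  define h where "h = min e0 e1 / 2"
  have h: "h > 0" "h < e0" "h < e1" using e0 e1 by (auto simp: h_def)
  have slack1: "\<Lambda> (\<eta> + h) < \<Lambda> \<eta> + h * (x + \<delta>)"
    using e1(2)[of h] h by (auto simp: field_simps abs_less_iff)
  have slack2: "\<Lambda> (\<eta> - h) < \<Lambda> \<eta> - h * (x - \<delta>)"
    using e1(2)[of "-h"] h by (auto simp: field_simps abs_less_iff)
  \<comment> \<open>An error of \<open>d\<close> in each of the growth rates leaves the two outer parts smaller than the whole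
  by a factor \<open>exp (- d t)\<close>.\<close>
  define d where "d = Min {\<Lambda> \<eta> + h * (x + \<delta>) - \<Lambda> (\<eta> + h), \<Lambda> \<eta> - h * (x - \<delta>) - \<Lambda> (\<eta> - h), g} / 4"
  have d: "d > 0" "4 * d \<le> \<Lambda> \<eta> + h * (x + \<delta>) - \<Lambda> (\<eta> + h)"
      "4 * d \<le> \<Lambda> \<eta> - h * (x - \<delta>) - \<Lambda> (\<eta> - h)" "4 * d \<le> g"
    using slack1 slack2 \<open>g > 0\<close> by (auto simp: d_def)
  have "\<forall>\<^sub>F t in at_top. ennreal (exp ((\<Lambda> \<eta> - d) * t)) \<le> mgf N (Y t) \<eta>"
    using e0(2)[of \<eta>] e0(1) d(1) unfolding has_exp_growth_def by auto
  moreover have "\<forall>\<^sub>F t in at_top. mgf N (Y t) (\<eta> + h) \<le> ennreal (exp ((\<Lambda> (\<eta> + h) + d) * t))"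
    using e0(2)[of "\<eta> + h"] h d(1) unfolding has_exp_growth_def by auto
  moreover have "\<forall>\<^sub>F t in at_top. mgf N (Y t) (\<eta> - h) \<le> ennreal (exp ((\<Lambda> (\<eta> - h) + d) * t))"
    using e0(2)[of "\<eta> - h"] h d(1) unfolding has_exp_growth_def by auto
  moreover have "\<forall>\<^sub>F t in at_top. 4 \<le> exp (d * t)" by (rule eventually_exp_ge) fact
  ultimately show ?thesis using eventually_gt_at_top[of 0]
  proof eventually_elim
    case (elim t)
    have [measurable]: "Y t \<in> borel_measurable N" using Y elim by auto
    have [measurable]: "U \<in> sets borel" using U by auto
    define E where "E = {\<omega> \<in> space N. Y t \<omega> / t \<in> U}"
    have [measurable]: "E \<in> sets N" unfolding E_def by measurable
    let ?B = "exp ((\<eta> * x + \<bar>\<eta>\<bar> * \<delta>) * t)"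
    let ?C = "exp (- (h * (x + \<delta>)) * t)" and ?D = "exp (h * (x - \<delta>) * t)"
    have "mgf N (Y t) \<eta> \<le> (\<integral>\<^sup>+\<omega>. ennreal ?B * indicator E \<omega>
         + ennreal ?C * ennreal (exp ((\<eta> + h) * Y t \<omega>)) + ennreal ?D * ennreal (exp ((\<eta> - h) * Y t \<omega>)) \<partial>N)"
      unfolding mgf_def
    proof (rule nn_integral_mono)
      fix \<omega> assume "\<omega> \<in> space N"
      then have "indicator (ball x \<delta>) (Y t \<omega> / t) \<le> (indicator E \<omega> :: real)"
        using \<delta>(2) by (auto simp: E_def indicator_def)
      then have "?B * indicator (ball x \<delta>) (Y t \<omega> / t) \<le> ?B * indicator E \<omega>"
        by (intro mult_left_mono) auto
      then have "exp (\<eta> * Y t \<omega>) \<le> ?B * indicator E \<omega> + ?C * exp ((\<eta> + h) * Y t \<omega>) + ?D * exp ((\<eta> - h) * Y t \<omega>)"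
        using tilted_exponential_bound[of t h \<eta> "Y t \<omega>" x \<delta>] elim h by linarith
      then have "ennreal (exp (\<eta> * Y t \<omega>)) \<le> ennreal (?B * indicator E \<omega> + ?C * exp ((\<eta> + h) * Y t \<omega>) + ?D * exp ((\<eta> - h) * Y t \<omega>))"
        by (rule ennreal_leI)
      also have "\<dots> = ennreal ?B * indicator E \<omega> + ennreal ?C * ennreal (exp ((\<eta> + h) * Y t \<omega>)) + ennreal ?D * ennreal (exp ((\<eta> - h) * Y t \<omega>))"
        by (simp add: ennreal_plus ennreal_mult ennreal_indicator[symmetric])
      finally show "ennreal (exp (\<eta> * Y t \<omega>)) \<le> \<dots>" .
    qed
    also have "\<dots> = ennreal ?B * emeasure N E + ennreal ?C * mgf N (Y t) (\<eta> + h) + ennreal ?D * mgf N (Y t) (\<eta> - h)"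
      unfolding mgf_def by (simp add: nn_integral_add nn_integral_cmult nn_integral_cmult_indicator)
    also have "\<dots> \<le> ennreal ?B * ennreal (prob E) + ennreal ?C * ennreal (exp ((\<Lambda> (\<eta> + h) + d) * t))
        + ennreal ?D * ennreal (exp ((\<Lambda> (\<eta> - h) + d) * t))"
      using elim by (intro add_mono mult_left_mono) (auto simp: emeasure_eq_measure)
    also have "\<dots> = ennreal (?B * prob E + ?C * exp ((\<Lambda> (\<eta> + h) + d) * t) + ?D * exp ((\<Lambda> (\<eta> - h) + d) * t))"
      by (simp add: ennreal_plus ennreal_mult)
    finally have "exp ((\<Lambda> \<eta> - d) * t) \<le> ?B * prob E + ?C * exp ((\<Lambda> (\<eta> + h) + d) * t) + ?D * exp ((\<Lambda> (\<eta> - h) + d) * t)"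
      using elim(1) by (subst ennreal_le_iff[symmetric]) (auto intro: order.trans)
    moreover have "?C * exp ((\<Lambda> (\<eta> + h) + d) * t) \<le> exp ((\<Lambda> \<eta> - 2 * d) * t)"
      using mult_right_mono[of "-(h*(x+\<delta>)) + (\<Lambda> (\<eta> + h) + d)" "\<Lambda> \<eta> - 2 * d" t] d elim
      by (simp add: exp_add[symmetric] algebra_simps)
    moreover have "?D * exp ((\<Lambda> (\<eta> - h) + d) * t) \<le> exp ((\<Lambda> \<eta> - 2 * d) * t)"
      using mult_right_mono[of "h*(x-\<delta>) + (\<Lambda> (\<eta> - h) + d)" "\<Lambda> \<eta> - 2 * d" t] d elim
      by (simp add: exp_add[symmetric] algebra_simps)
    moreover have "4 * exp ((\<Lambda> \<eta> - 2 * d) * t) \<le> exp ((\<Lambda> \<eta> - d) * t)"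
    proof -
      have "exp ((\<Lambda> \<eta> - d) * t) = exp (d * t) * exp ((\<Lambda> \<eta> - 2 * d) * t)"
        by (simp add: exp_add[symmetric] algebra_simps)
      then show ?thesis using elim(4) by simp
    qed
    ultimately have "exp ((\<Lambda> \<eta> - 2 * d) * t) \<le> ?B * prob E"
      using exp_gt_zero[of "(\<Lambda> \<eta> - 2 * d) * t"] by linarith
    then have "exp ((\<Lambda> \<eta> - 2 * d) * t) / ?B \<le> prob E" by (simp add: field_simps)
    moreover have "exp (r * t) \<le> exp ((\<Lambda> \<eta> - 2 * d) * t) / ?B"
      using mult_right_mono[of r "(\<Lambda> \<eta> - 2 * d) - (\<eta> * x + \<bar>\<eta>\<bar> * \<delta>)" t] d elim \<delta>g
      by (simp add: exp_diff[symmetric] algebra_simps g_def)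
    ultimately show ?case
      unfolding E_def[symmetric] by (simp add: emeasure_eq_measure ennreal_leI)
  qed
qed

section \<open>Slopes of a nonnegative essentially smooth function\<close>

text \<open>
  Derivatives have the intermediate value property without being continuous: \<open>f x - y x\<close> attains its
  minimum over the interval, and the signs of its slopes at the ends push the minimum into the interior.
\<close>

lemma darboux_derivative:
  fixes f f' :: "real \<Rightarrow> real"
  assumes "a \<le> b" and deriv: "\<And>x. x \<in> {a..b} \<Longrightarrow> (f has_real_derivative f' x) (at x)"
    and "f' a \<le> y" "y \<le> f' b"
  shows "\<exists>c\<in>{a..b}. f' c = y"
proof (cases "f' a = y \<or> f' b = y")
  case True
  then show ?thesis using \<open>a \<le> b\<close> by auto
next
  case False
  then have lt: "f' a < y" "y < f' b" using assms by auto
  then have "a < b" using \<open>a \<le> b\<close> by (cases "a = b") auto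
  define g where "g x = f x - y * x" for x
  have g: "(g has_real_derivative f' x - y) (at x)" if "x \<in> {a..b}" for x
    unfolding g_def using deriv[OF that] by (auto intro!: derivative_eq_intros)
  have "continuous_on {a..b} g"
    by (rule DERIV_continuous_on) (use g has_field_derivative_at_within in blast)
  then obtain c where c: "c \<in> {a..b}" "\<And>z. z \<in> {a..b} \<Longrightarrow> g c \<le> g z"
    using continuous_attains_inf[of "{a..b}" g] \<open>a \<le> b\<close> by auto
  have "c \<noteq> a"
  proof
    assume "c = a"
    obtain d where d: "d > 0" "\<And>h. 0 < h \<Longrightarrow> h < d \<Longrightarrow> g (a + h) < g a"
      using DERIV_neg_dec_right[OF g[of a]] lt \<open>a < b\<close> by auto
    define h where "h = min d (b - a) / 2"
    have "0 < h" "h < d" "a + h \<in> {a..b}" using d(1) \<open>a < b\<close> by (auto simp: h_def min_def field_simps)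
    then show False using d(2)[of h] c(2)[of "a + h"] \<open>c = a\<close> by auto
  qed
  moreover have "c \<noteq> b"
  proof
    assume "c = b"
    obtain d where d: "d > 0" "\<And>h. 0 < h \<Longrightarrow> h < d \<Longrightarrow> g (b - h) < g b"
      using DERIV_pos_inc_left[OF g[of b]] lt \<open>a < b\<close> by auto
    define h where "h = min d (b - a) / 2"
    have "0 < h" "h < d" "b - h \<in> {a..b}" using d(1) \<open>a < b\<close> by (auto simp: h_def min_def field_simps)
    then show False using d(2)[of h] c(2)[of "b - h"] \<open>c = b\<close> by auto
  qed
  ultimately have "a < c" "c < b" using c(1) by auto
  define d where "d = min (c - a) (b - c)"
  have "f' c - y = 0"
  proof (rule DERIV_local_min[OF g[OF c(1)]])
    show "0 < d" using \<open>a < c\<close> \<open>c < b\<close> by (simp add: d_def)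
    show "\<forall>z. \<bar>c - z\<bar> < d \<longrightarrow> g c \<le> g z" using c(2) by (auto simp: d_def abs_less_iff)
  qed
  then show ?thesis using c(1) by auto
qed

lemma interior_of_star_shaped:
  fixes D :: "real set"
  assumes "0 \<in> interior D" and star: "\<And>\<theta> p. \<theta> \<in> D \<Longrightarrow> 0 \<le> p \<Longrightarrow> p \<le> 1 \<Longrightarrow> p * \<theta> \<in> D"
    and "\<theta> \<in> D" "0 \<le> p" "p < 1"
  shows "p * \<theta> \<in> interior D"
proof (cases "p = 0 \<or> \<theta> = 0")
  case True
  then show ?thesis using assms(1) by auto
next
  case False
  then have "p > 0" "\<theta> \<noteq> 0" using assms by auto
  define \<rho> where "\<rho> = min p (1 - p) * \<bar>\<theta>\<bar>"
  have "\<rho> > 0" using \<open>p > 0\<close> \<open>p < 1\<close> \<open>\<theta> \<noteq> 0\<close> by (auto simp: \<rho>_def)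
  have "ball (p * \<theta>) \<rho> \<subseteq> D"
  proof
    fix z assume z: "z \<in> ball (p * \<theta>) \<rho>"
    have "\<bar>p - z / \<theta>\<bar> * \<bar>\<theta>\<bar> = \<bar>p * \<theta> - z\<bar>"
      using \<open>\<theta> \<noteq> 0\<close> by (simp add: abs_mult[symmetric] algebra_simps)
    also have "\<dots> < \<rho>" using z by (simp add: dist_real_def)
    finally have "\<bar>p - z / \<theta>\<bar> < min p (1 - p)"
      unfolding \<rho>_def using \<open>\<theta> \<noteq> 0\<close> by (simp add: mult_less_cancel_right)
    then have "0 \<le> z / \<theta>" "z / \<theta> \<le> 1" by (auto simp only: abs_less_iff min_less_iff_conj)
    from star[OF \<open>\<theta> \<in> D\<close> this] show "z \<in> D" using \<open>\<theta> \<noteq> 0\<close> by simp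
  qed
  then show ?thesis using \<open>\<rho> > 0\<close> mem_interior by blast
qed

lemma legendre_transform_ge: "ereal (\<theta> * x) - \<Lambda> \<theta> \<le> legendre_transform \<Lambda> x"
  unfolding legendre_transform_def by (rule SUP_upper) simp

lemma legendre_transform_nonneg:
  assumes "\<Lambda> 0 = 0"
  shows "0 \<le> legendre_transform \<Lambda> x"
  using legendre_transform_ge[of 0 x \<Lambda>] assms by (simp add: zero_ereal_def)

text \<open>
  Since \<open>\<Lambda>\<close> is nonnegative, a \<open>\<theta>\<close> whose sign is opposite to that of \<open>x\<close> contributes nothing
  beyond the value at \<open>\<theta> = 0\<close>; for the others the linear term only shrinks when \<open>x\<close> moves towards
  \<open>0\<close>.
\<close>

lemma legendre_transform_mono_ray:
  assumes nonneg: "\<And>\<theta>. 0 \<le> \<Lambda> \<theta>" and "\<Lambda> 0 = 0" and p: "0 \<le> p" "p \<le> 1"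
  shows "legendre_transform \<Lambda> (p * x) \<le> legendre_transform \<Lambda> x"
  unfolding legendre_transform_def[of \<Lambda> "p * x"]
proof (rule SUP_least)
  fix \<theta> :: real
  show "ereal (\<theta> * (p * x)) - \<Lambda> \<theta> \<le> legendre_transform \<Lambda> x"
  proof (cases "0 \<le> \<theta> * x")
    case True
    have "\<theta> * (p * x) \<le> \<theta> * x"
      using mult_right_mono[OF p(2) True] by (simp add: algebra_simps)
    then have "ereal (\<theta> * (p * x)) - \<Lambda> \<theta> \<le> ereal (\<theta> * x) - \<Lambda> \<theta>"
      by (intro ereal_minus_mono) auto
    also have "\<dots> \<le> legendre_transform \<Lambda> x" by (rule legendre_transform_ge)
    finally show ?thesis .
  next
    case False
    have "\<theta> * (p * x) \<le> 0"
      using mult_nonneg_nonpos[of p "\<theta> * x"] False p by (simp add: algebra_simps)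
    then have "ereal (\<theta> * (p * x)) - \<Lambda> \<theta> \<le> 0 - 0"
      using nonneg[of \<theta>] by (intro ereal_minus_mono) auto
    also have "\<dots> \<le> legendre_transform \<Lambda> x" using legendre_transform_nonneg[of \<Lambda> x] \<open>\<Lambda> 0 = 0\<close> by simp
    finally show ?thesis .
  qed
qed

text \<open>
  Let \<open>x \<noteq> 0\<close> have sign \<open>s\<close> and follow \<open>\<Lambda>\<close> along the ray \<open>s r\<close> with \<open>r \<ge> 0\<close>.  The slope is \<open>0\<close> at
  \<open>r = 0\<close>, and it cannot stay below \<open>\<bar>x\<bar>\<close> by a fixed amount: if the ray leaves the domain, then
  this contradicts steepness; if it does not, then \<open>\<Lambda>\<close> grows more slowly than \<open>r \<bar>x\<bar>\<close> and the
  Legendre transform would be infinite at \<open>x\<close>.  Darboux's theorem then provides a slope between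
  \<open>0\<close> and \<open>x\<close> as close to \<open>x\<close> as desired, and the rate is not larger there.
\<close>

lemma exposed_point_approximation:
  fixes \<Lambda> :: "real \<Rightarrow> ereal"
  assumes smooth: "essentially_smooth \<Lambda>"
    and nonneg: "\<And>\<theta>. 0 \<le> \<Lambda> \<theta>" and zero: "\<Lambda> 0 = 0"
    and star: "\<And>\<theta> p. 0 \<le> p \<Longrightarrow> p \<le> 1 \<Longrightarrow> \<Lambda> (p * \<theta>) \<le> \<Lambda> \<theta>"
    and int0: "0 \<in> interior (eff_domain \<Lambda>)"
    and U: "open U" "x \<in> U" and fin: "legendre_transform \<Lambda> x < \<infinity>"
  shows "\<exists>\<eta> y. \<eta> \<in> interior (eff_domain \<Lambda>) \<and> y \<in> U \<and>
    ((\<lambda>\<theta>. real_of_ereal (\<Lambda> \<theta>)) has_real_derivative y) (at \<eta>) \<and>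
    legendre_transform \<Lambda> y \<le> legendre_transform \<Lambda> x"
proof -
  define D where "D = eff_domain \<Lambda>"
  define f where "f = (\<lambda>\<theta>. real_of_ereal (\<Lambda> \<theta>))"
  have D_iff: "\<theta> \<in> D \<longleftrightarrow> \<Lambda> \<theta> < \<infinity>" for \<theta> by (simp add: D_def eff_domain_def)
  have f: "\<Lambda> \<theta> = ereal (f \<theta>)" if "\<theta> \<in> D" for \<theta>
    using that nonneg[of \<theta>] by (cases "\<Lambda> \<theta>") (auto simp: f_def D_iff)
  have starD: "p * \<theta> \<in> D" if "\<theta> \<in> D" "0 \<le> p" "p \<le> 1" for \<theta> p
    using star[OF that(2,3), of \<theta>] that(1) by (auto simp: D_iff)
  have int0D: "0 \<in> interior D" using int0 by (simp add: D_def)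
  have intD: "p * \<theta> \<in> interior D" if "\<theta> \<in> D" "0 \<le> p" "p < 1" for \<theta> p
    by (rule interior_of_star_shaped[OF int0D starD]) (use that in auto)
  have derivf: "(f has_real_derivative deriv f \<theta>) (at \<theta>)" if "\<theta> \<in> interior D" for \<theta>
  proof -
    have "f differentiable at \<theta>"
      using smooth that unfolding essentially_smooth_def f_def D_def by blast
    then show ?thesis by (simp add: DERIV_deriv_iff_real_differentiable)
  qed
  have f_mono: "f (p * \<theta>) \<le> f \<theta>" if "\<theta> \<in> D" "0 \<le> p" "p \<le> 1" for \<theta> p
    using star[OF that(2,3), of \<theta>] that(1) starD[OF that] by (simp add: f)
  have f_nonneg: "0 \<le> f \<theta>" for \<theta> using nonneg[of \<theta>] by (simp add: f_def real_of_ereal_pos)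
  have f0: "f 0 = 0" by (simp add: f_def zero)
  have deriv0: "deriv f 0 = 0"
    by (rule DERIV_local_min[OF derivf[OF int0D], of 1]) (auto simp: f0 f_nonneg)
  have steep: "\<forall>\<theta>s \<theta>. (\<forall>n. \<theta>s n \<in> interior D) \<and> \<theta> \<in> frontier D \<and> \<theta>s \<longlonglongrightarrow> \<theta> \<longrightarrow>
      filterlim (\<lambda>n. \<bar>deriv f (\<theta>s n)\<bar>) at_top sequentially"
    using smooth unfolding essentially_smooth_def f_def D_def by simp
  show ?thesis
  proof (cases "x = 0")
    case True
    then show ?thesis using int0D derivf[OF int0D] U by (auto simp: D_def f_def deriv0[unfolded f_def])
  next
    case False
    define s where "s = sgn x"
    have s: "s * s = 1" "s * x = \<bar>x\<bar>" "\<bar>s\<bar> = 1" "s \<noteq> 0"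
      using False by (auto simp: s_def sgn_real_def)
    obtain \<epsilon> where \<epsilon>: "\<epsilon> > 0" "ball x \<epsilon> \<subseteq> U" using U openE by blast
    \<comment> \<open>For \<open>m < v \<le> \<bar>x\<bar>\<close> the point \<open>s v\<close> lies in \<open>U\<close> and between \<open>0\<close> and \<open>x\<close>.\<close>
    define m where "m = \<bar>x\<bar> - min (\<epsilon> / 2) (\<bar>x\<bar> / 2)"
    have m: "0 < m" "m < \<bar>x\<bar>" "\<bar>x\<bar> - m < \<epsilon>" using False \<epsilon> by (auto simp: m_def min_def)
    define g where "g r = f (s * r)" for r
    define g' where "g' r = s * deriv f (s * r)" for r
    have derivg: "(g has_real_derivative g' r) (at r)" if "s * r \<in> interior D" for r
      unfolding g_def g'_def
      by (rule DERIV_cong[OF DERIV_chain2[where g = "\<lambda>r. s * r", OF derivf[OF that]]])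
        (auto intro!: derivative_eq_intros)
    \<comment> \<open>\<open>\<Lambda>\<close> does not decrease along the ray, so steepness can only mean slopes tending to \<open>+\<infinity>\<close>.\<close>
    have g'_nonneg: "0 \<le> g' r" if "0 \<le> r" and r: "s * r \<in> interior D" for r
    proof (rule ccontr)
      assume "\<not> 0 \<le> g' r"
      then obtain d where d: "d > 0" "\<And>h. 0 < h \<Longrightarrow> h < d \<Longrightarrow> g (r + h) < g r"
        using DERIV_neg_dec_right[OF derivg[OF r]] by auto
      obtain e where e: "e > 0" "ball (s * r) e \<subseteq> D" using r mem_interior by blast
      define h where "h = min d e / 2"
      have h: "0 < h" "h < d" "h < e" using d e by (auto simp: h_def)
      have "dist (s * r) (s * (r + h)) = \<bar>s\<bar> * \<bar>h\<bar>"
        by (simp add: dist_real_def algebra_simps abs_mult)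
      then have "s * (r + h) \<in> D" using e h s by (auto simp: subset_eq)
      from f_mono[OF this, of "r / (r + h)"] have "g r \<le> g (r + h)"
        using h \<open>0 \<le> r\<close> by (simp add: g_def mult.commute)
      then show False using d(2)[OF h(1,2)] by simp
    qed
    have "\<exists>r\<ge>0. s * r \<in> interior D \<and> m < g' r"
    proof (rule ccontr)
      assume "\<not> ?thesis"
      then have le_m: "g' r \<le> m" if "r \<ge> 0" "s * r \<in> interior D" for r using that by force
      show False
      proof (cases "\<forall>r\<ge>0. s * r \<in> D")
        case True
        have ray: "s * r \<in> interior D" if "r \<ge> 0" for r
          using intD[of "s * (r + 1)" "r / (r + 1)"] True that by (simp add: mult.commute)
        have "ereal (r * (\<bar>x\<bar> - m)) \<le> legendre_transform \<Lambda> x" if "r \<ge> 0" for r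
        proof -
          have "m * 0 - g 0 \<le> m * r - g r"
          proof (rule DERIV_nonneg_imp_nondecreasing[OF that])
            fix z :: real assume "0 \<le> z" "z \<le> r"
            then show "\<exists>y. ((\<lambda>r. m * r - g r) has_real_derivative y) (at z) \<and> 0 \<le> y"
              using derivg[OF ray, of z] le_m[OF _ ray, of z]
              by (intro exI[of _ "m - g' z"]) (auto intro!: derivative_eq_intros)
          qed
          then have "g r \<le> m * r" by (simp add: g_def f0)
          then have "r * (\<bar>x\<bar> - m) \<le> (s * r) * x - f (s * r)"
            using s(2) by (simp add: g_def algebra_simps)
          then have "ereal (r * (\<bar>x\<bar> - m)) \<le> ereal ((s * r) * x) - \<Lambda> (s * r)"
            using True that by (simp add: f)
          also have "\<dots> \<le> legendre_transform \<Lambda> x" by (rule legendre_transform_ge)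
          finally show ?thesis .
        qed note ray_bound = this
        obtain K where K: "legendre_transform \<Lambda> x \<le> ereal K" "K \<ge> 0"
          using fin legendre_transform_nonneg[of \<Lambda> x] zero
          by (cases "legendre_transform \<Lambda> x") auto
        have "ereal (K + 1) \<le> legendre_transform \<Lambda> x"
          using ray_bound[of "(K + 1) / (\<bar>x\<bar> - m)"] K m by simp
        also note K(1)
        finally show False by simp
      next
        case False
        then obtain r0 where r0: "r0 \<ge> 0" "s * r0 \<notin> D" by blast
        define B where "B = {r. 0 \<le> r \<and> s * r \<in> D}"
        have bdd: "r \<le> r0" if "r \<in> B" for r
        proof (rule ccontr)
          assume "\<not> r \<le> r0"
          then show False
            using starD[of "s * r" "r0 / r"] that r0 by (auto simp: B_def mult.commute)
        qed
        then have "bdd_above B" by (auto simp: bdd_above_def)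
        \<comment> \<open>The point at which the ray leaves the domain.\<close>
        define b where "b = Sup B"
        obtain e where e: "e > 0" "ball 0 e \<subseteq> D" using int0D mem_interior by blast
        have "e / 2 \<in> B" using e s by (auto simp: B_def subset_eq abs_mult)
        from this cSup_upper[OF this \<open>bdd_above B\<close>] have "b > 0" "B \<noteq> {}" using e by (auto simp: b_def)
        have inside: "s * r \<in> interior D" if "0 \<le> r" "r < b" for r
        proof -
          obtain r' where "r' \<in> B" "r < r'"
            using \<open>r < b\<close> less_cSup_iff[OF \<open>B \<noteq> {}\<close> \<open>bdd_above B\<close>] by (auto simp: b_def)
          then show ?thesis using intD[of "s * r'" "r / r'"] that by (auto simp: B_def mult.commute)
        qed
        define \<rho> where "\<rho> n = b - b / real (n + 2)" for n
        have \<rho>: "0 \<le> \<rho> n" "\<rho> n < b" for n using \<open>b > 0\<close> by (auto simp: \<rho>_def field_simps)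
        have "(\<lambda>n. b / real (n + 2)) \<longlonglongrightarrow> 0"
          by (rule LIMSEQ_ignore_initial_segment) (rule lim_const_over_n)
        then have "\<rho> \<longlonglongrightarrow> b - 0" unfolding \<rho>_def by (intro tendsto_diff tendsto_const)
        then have lim: "(\<lambda>n. s * \<rho> n) \<longlonglongrightarrow> s * b" by (intro tendsto_mult tendsto_const) simp
        have "s * b \<in> closure D"
          unfolding closure_sequential
          by (intro exI[of _ "\<lambda>n. s * \<rho> n"] conjI allI lim subsetD[OF interior_subset inside] \<rho>)
        moreover have "s * b \<notin> interior D"
        proof
          assume "s * b \<in> interior D"
          then obtain e where e: "e > 0" "ball (s * b) e \<subseteq> D" using mem_interior by blast
          have "dist (s * b) (s * (b + e / 2)) = \<bar>s\<bar> * \<bar>e / 2\<bar>"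
            by (simp add: dist_real_def algebra_simps abs_mult)
          then have "b + e / 2 \<in> B" using e s \<open>b > 0\<close> by (auto simp: B_def subset_eq)
          from cSup_upper[OF this \<open>bdd_above B\<close>] show False using e by (simp add: b_def)
        qed
        ultimately have "s * b \<in> frontier D" by (simp add: frontier_def)
        then have "(\<forall>n. s * \<rho> n \<in> interior D) \<and> s * b \<in> frontier D \<and> (\<lambda>n. s * \<rho> n) \<longlonglongrightarrow> s * b"
          using lim inside[OF \<rho>] by simp
        then have "filterlim (\<lambda>n. \<bar>deriv f (s * \<rho> n)\<bar>) at_top sequentially"
          by (rule steep[rule_format])
        then have "\<forall>\<^sub>F n in sequentially. m + 1 \<le> \<bar>deriv f (s * \<rho> n)\<bar>"
          by (auto simp: filterlim_at_top)
        then obtain n where n: "m + 1 \<le> \<bar>deriv f (s * \<rho> n)\<bar>"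
          by (auto simp: eventually_sequentially)
        have "\<bar>g' (\<rho> n)\<bar> = \<bar>deriv f (s * \<rho> n)\<bar>" using s by (simp add: g'_def abs_mult)
        then show False using n le_m[OF \<rho>(1) inside[OF \<rho>], of n] g'_nonneg[OF \<rho>(1) inside[OF \<rho>], of n] by simp
      qed
    qed
    then obtain r where r: "r \<ge> 0" "s * r \<in> interior D" "m < g' r" by blast
    define v where "v = min \<bar>x\<bar> (g' r)"
    have v: "m < v" "v \<le> \<bar>x\<bar>" "v \<le> g' r" using r m by (auto simp: v_def)
    have seg: "s * c \<in> interior D" if "c \<in> {0..r}" for c
    proof (cases "c = r")
      case False
      then show ?thesis
        using intD[OF subsetD[OF interior_subset r(2)], of "c / r"] that by (auto simp: mult.commute)
    qed (use r in simp)
    have "\<exists>c\<in>{0..r}. g' c = v"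
      by (rule darboux_derivative[of 0 r g g'])
        (use r seg derivg v m in \<open>auto simp: g'_def deriv0\<close>)
    then obtain c where c: "c \<in> {0..r}" "g' c = v" by blast
    have "s * v = (s * s) * deriv f (s * c)" using c(2) by (simp add: g'_def)
    then have "deriv f (s * c) = s * v" by (simp only: s(1) mult_1)
    then have der: "(f has_real_derivative s * v) (at (s * c))" using derivf[OF seg[OF c(1)]] by simp
    have "x = s * \<bar>x\<bar>" by (simp add: s_def sgn_real_def)
    then have "x - s * v = s * \<bar>x\<bar> - s * v" by (rule arg_cong)
    then have "dist x (s * v) = \<bar>s\<bar> * \<bar>\<bar>x\<bar> - v\<bar>"
      unfolding dist_real_def by (simp only: right_diff_distrib[symmetric] abs_mult)
    then have "s * v \<in> U" using v m s \<epsilon> by (auto simp: subset_eq)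
    have "s * v = v / \<bar>x\<bar> * x"
      using False by (simp add: s_def sgn_real_def)
    then have "legendre_transform \<Lambda> (s * v) \<le> legendre_transform \<Lambda> x"
      using legendre_transform_mono_ray[of \<Lambda> "v / \<bar>x\<bar>" x] nonneg zero v m False by simp
    then show ?thesis using der \<open>s * v \<in> U\<close> seg[OF c(1)] by (auto simp: D_def f_def)
  qed
qed

section \<open>The Gartner-Ellis theorem for a nonnegative limit\<close>

lemma scaled_ln_ennreal_ge:
  assumes "0 < t" "ennreal (exp (c * t)) \<le> p"
  shows "ereal c \<le> ereal (1 / t) * ln_ennreal p"
proof (cases p)
  case (real q)
  then have "exp (c * t) \<le> q" using assms by simp
  then have "q > 0" by (smt (verit) exp_gt_zero)
  then have "c * t \<le> ln q" using \<open>exp (c * t) \<le> q\<close> by (simp add: ln_ge_iff)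
  then have "c \<le> (1 / t) * ln q" using assms by (simp add: field_simps)
  moreover have "ln_ennreal p = ereal (ln q)"
    using real \<open>q > 0\<close> by (simp add: ln_ennreal_def)
  ultimately show ?thesis by simp
next
  case top
  then show ?thesis using assms by (simp add: ln_ennreal_def)
qed

lemma scaled_ln_ennreal_le:
  assumes "0 < t" "p \<le> ennreal (exp (c * t))"
  shows "ereal (1 / t) * ln_ennreal p \<le> ereal c"
proof (cases "p = 0")
  case True
  then show ?thesis using assms by (simp add: ln_ennreal_def)
next
  case False
  have "p < \<infinity>" using assms(2) by (simp add: order.strict_trans1)
  then obtain q where q: "p = ennreal q" "q > 0" using False
    by (cases p) (auto simp: less_le)
  then have "q \<le> exp (c * t)" using assms by simp
  then have "ln q \<le> c * t" using q by (metis ln_exp ln_le_cancel_iff exp_gt_zero)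
  then have "(1 / t) * ln q \<le> c" using assms by (simp add: field_simps)
  moreover have "ln_ennreal p = ereal (ln q)"
    using q by (simp add: ln_ennreal_def)
  ultimately show ?thesis by simp
qed

lemma closed_legendre_sublevel:
  assumes "\<And>\<theta>. \<Lambda> \<theta> \<noteq> -\<infinity>"
  shows "closed {x. legendre_transform \<Lambda> x \<le> a}"
proof -
  have "{x. legendre_transform \<Lambda> x \<le> a} = (\<Inter>\<theta>. {x. ereal (\<theta> * x) - \<Lambda> \<theta> \<le> a})"
    by (auto simp: legendre_transform_def SUP_le_iff)
  moreover have "closed {x. ereal (\<theta> * x) - \<Lambda> \<theta> \<le> a}" for \<theta>
  proof (cases "\<Lambda> \<theta>")
    case (real l)
    have "continuous_on UNIV (\<lambda>x. ereal (\<theta> * x - l))"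
      by (intro continuous_intros)
    then show ?thesis using real by (auto intro!: closed_Collect_le continuous_on_const)
  qed (use assms in auto)
  ultimately show ?thesis by auto
qed

text \<open>
  Finiteness of \<open>\<Lambda>\<close> at two points of opposite sign makes its Legendre transform grow at least
  linearly in both directions.
\<close>

lemma good_rate_function_legendre:
  assumes nonneg: "\<And>\<theta>. 0 \<le> \<Lambda> \<theta>" and int0: "0 \<in> interior (eff_domain \<Lambda>)"
  shows "good_rate_function (legendre_transform \<Lambda>)"
  unfolding good_rate_function_def
proof (intro allI impI)
  fix b :: real
  obtain e where e: "e > 0" "ball 0 e \<subseteq> eff_domain \<Lambda>" using int0 mem_interior by blast
  have "e / 2 \<in> eff_domain \<Lambda>" "- (e / 2) \<in> eff_domain \<Lambda>"
    using e by (auto simp: subset_eq)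
  then obtain l1 l2 where l: "\<Lambda> (e / 2) = ereal l1" "\<Lambda> (- (e / 2)) = ereal l2"
    using nonneg[of "e / 2"] nonneg[of "- (e / 2)"]
    by (cases "\<Lambda> (e / 2)"; cases "\<Lambda> (- (e / 2))") (auto simp: eff_domain_def)
  have "\<bar>x\<bar> \<le> (\<bar>b\<bar> + \<bar>l1\<bar> + \<bar>l2\<bar>) / (e / 2)" if "legendre_transform \<Lambda> x \<le> ereal b" for x
  proof -
    have "ereal (e / 2 * x) - \<Lambda> (e / 2) \<le> ereal b" "ereal (- (e / 2) * x) - \<Lambda> (- (e / 2)) \<le> ereal b"
      using that legendre_transform_ge order.trans by blast+
    then have "e / 2 * x - l1 \<le> b" "- (e / 2) * x - l2 \<le> b" by (auto simp: l)
    then have "e / 2 * \<bar>x\<bar> \<le> \<bar>b\<bar> + \<bar>l1\<bar> + \<bar>l2\<bar>" by (cases "x \<ge> 0") auto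
    then show ?thesis using e by (simp add: field_simps)
  qed
  then have "bounded {x. legendre_transform \<Lambda> x \<le> ereal b}"
    unfolding bounded_iff by auto
  moreover have "closed {x. legendre_transform \<Lambda> x \<le> ereal b}"
    using nonneg by (intro closed_legendre_sublevel) (metis ereal_infty_less_eq(2) MInfty_neq_ereal(1) zero_ereal_def)
  ultimately show "compact {x. legendre_transform \<Lambda> x \<le> ereal b}"
    by (simp add: compact_eq_bounded_closed)
qed

text \<open>
  On either side of \<open>0\<close> the part of \<open>C\<close> there lies beyond its point \<open>x\<close> nearest to \<open>0\<close>.  A \<open>\<theta>\<close>
  that witnesses \<open>I x > c \<ge> 0\<close> satisfies \<open>\<theta> x > 0\<close>, because \<open>\<Lambda> \<theta> \<ge> 0\<close>, so it points away from
  \<open>0\<close> and its Chernoff bound covers that whole side.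
\<close>

lemma closed_set_exponential_bound:
  fixes \<Lambda> :: "real \<Rightarrow> ereal" and Y :: "real \<Rightarrow> 'a \<Rightarrow> real"
  assumes Y: "\<And>t. 0 < t \<Longrightarrow> Y t \<in> borel_measurable N"
    and nonneg: "\<And>\<theta>. 0 \<le> \<Lambda> \<theta>"
    and growth: "\<And>\<theta>. \<theta> \<in> eff_domain \<Lambda> \<Longrightarrow>
      has_exp_growth (\<lambda>t. mgf N (Y t) \<theta>) (real_of_ereal (\<Lambda> \<theta>))"
    and C: "closed C" and c: "0 \<le> c" "\<And>x. x \<in> C \<Longrightarrow> ereal c < legendre_transform \<Lambda> x"
  shows "\<forall>\<^sub>F t in at_top. emeasure N {\<omega> \<in> space N. Y t \<omega> / t \<in> C} \<le> 2 * ennreal (exp (- c * t))"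
proof -
  have [measurable]: "C \<in> sets borel" using C by simp
  have side: "\<forall>\<^sub>F t in at_top. emeasure N {\<omega> \<in> space N. Y t \<omega> / t \<in> C \<and> 0 \<le> s * (Y t \<omega> / t)}
      \<le> ennreal (exp (- c * t))" if s: "\<bar>s\<bar> = 1" for s
  proof (cases "{z \<in> C. 0 \<le> s * z} = {}")
    case True
    then have "{\<omega> \<in> space N. Y t \<omega> / t \<in> C \<and> 0 \<le> s * (Y t \<omega> / t)} = {}" for t by blast
    then show ?thesis by (simp only: emeasure_empty) simp
  next
    case False
    have "closed {z. 0 \<le> s * z}" by (intro closed_Collect_le continuous_intros)
    then have "closed {z \<in> C. 0 \<le> s * z}" using C by (simp add: Collect_conj_eq closed_Int)
    from distance_attains_inf[OF this False, of 0]
    obtain x where "x \<in> {z \<in> C. 0 \<le> s * z}" "\<And>z. z \<in> {z \<in> C. 0 \<le> s * z} \<Longrightarrow> dist 0 x \<le> dist 0 z"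
      by blast
    then have x: "x \<in> C" "0 \<le> s * x" "\<And>z. z \<in> C \<Longrightarrow> 0 \<le> s * z \<Longrightarrow> \<bar>x\<bar> \<le> \<bar>z\<bar>"
      by auto
    obtain \<theta> where \<theta>: "ereal c < ereal (\<theta> * x) - \<Lambda> \<theta>"
      using c(2)[OF x(1)] unfolding legendre_transform_def less_SUP_iff by blast
    then obtain l where l: "\<Lambda> \<theta> = ereal l" using nonneg[of \<theta>] by (cases "\<Lambda> \<theta>") auto
    have "l \<ge> 0" "c < \<theta> * x - l" using \<theta> l nonneg[of \<theta>] by auto
    then have "\<theta> * x > 0" using c by linarith
    have "has_exp_growth (\<lambda>t. mgf N (Y t) \<theta>) l"
      using growth[of \<theta>] l by (simp add: eff_domain_def)
    then have "\<forall>\<^sub>F t in at_top. emeasure N {\<omega> \<in> space N. \<theta> * x \<le> \<theta> * (Y t \<omega> / t)} \<le> ennreal (exp (- c * t))"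
      using Y \<open>c < \<theta> * x - l\<close> by (intro half_line_exponential_bound)
    then show ?thesis using eventually_gt_at_top[of 0]
    proof eventually_elim
      case (elim t)
      have [measurable]: "Y t \<in> borel_measurable N" using Y elim by auto
      have "\<theta> * x \<le> \<theta> * z" if "z \<in> C" "0 \<le> s * z" for z
      proof -
        have "s = 1 \<or> s = -1" using s by linarith
        then have "\<theta> * z = \<bar>\<theta>\<bar> * \<bar>z\<bar>" "\<theta> * x = \<bar>\<theta>\<bar> * \<bar>x\<bar>"
          using that(2) x(2) \<open>\<theta> * x > 0\<close> by (auto simp: zero_less_mult_iff)
        then show ?thesis using x(3)[OF that] by (simp add: mult_left_mono)
      qed
      then have "emeasure N {\<omega> \<in> space N. Y t \<omega> / t \<in> C \<and> 0 \<le> s * (Y t \<omega> / t)}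
          \<le> emeasure N {\<omega> \<in> space N. \<theta> * x \<le> \<theta> * (Y t \<omega> / t)}"
        by (intro emeasure_mono, blast) measurable
      also note elim(1)
      finally show ?case .
    qed
  qed
  from side[of 1, OF abs_one] side[of "-1", OF abs_neg_one] eventually_gt_at_top[of 0] show ?thesis
  proof eventually_elim
    case (elim t)
    have [measurable]: "Y t \<in> borel_measurable N" using Y elim by auto
    let ?E = "\<lambda>s. {\<omega> \<in> space N. Y t \<omega> / t \<in> C \<and> 0 \<le> s * (Y t \<omega> / t)}"
    have "emeasure N {\<omega> \<in> space N. Y t \<omega> / t \<in> C} \<le> emeasure N (?E 1 \<union> ?E (-1))"
      by (intro emeasure_mono) auto
    also have "\<dots> \<le> emeasure N (?E 1) + emeasure N (?E (-1))"
      by (intro emeasure_subadditive) auto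
    also have "\<dots> \<le> ennreal (exp (- c * t)) + ennreal (exp (- c * t))"
      using elim by (intro add_mono) auto
    finally show ?case by (simp add: mult_2)
  qed
qed

text \<open>
  The hypothesis that \<open>\<Lambda>\<close> does not increase when its argument is contracted towards \<open>0\<close> is what
  convexity of a limiting cumulant generating function with minimum \<open>0\<close> at the origin provides.
\<close>

theorem gaertner_ellis_nonneg:
  fixes \<Lambda> :: "real \<Rightarrow> ereal" and Y :: "real \<Rightarrow> 'a \<Rightarrow> real"
  assumes "prob_space N"
    and Y: "\<And>t. 0 < t \<Longrightarrow> Y t \<in> borel_measurable N"
    and smooth: "essentially_smooth \<Lambda>"
    and nonneg: "\<And>\<theta>. 0 \<le> \<Lambda> \<theta>" and zero: "\<Lambda> 0 = 0"
    and star: "\<And>\<theta> p. 0 \<le> p \<Longrightarrow> p \<le> 1 \<Longrightarrow> \<Lambda> (p * \<theta>) \<le> \<Lambda> \<theta>"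
    and int0: "0 \<in> interior (eff_domain \<Lambda>)"
    and growth: "\<And>\<theta>. \<theta> \<in> eff_domain \<Lambda> \<Longrightarrow>
      has_exp_growth (\<lambda>t. mgf N (Y t) \<theta>) (real_of_ereal (\<Lambda> \<theta>))"
  shows "satisfies_LDP N (\<lambda>t \<omega>. Y t \<omega> / t) (\<lambda>t. t) (legendre_transform \<Lambda>)"
proof -
  interpret prob_space N by fact
  let ?I = "legendre_transform \<Lambda>"
  have I_nonneg: "0 \<le> ?I x" for x using legendre_transform_nonneg[of \<Lambda> x] zero by simp
  have upper: "Limsup at_top (\<lambda>t. ereal (1 / t) * ln_ennreal (emeasure N {\<omega> \<in> space N. Y t \<omega> / t \<in> C}))
      \<le> - (INF x\<in>C. ?I x)" if C: "closed C" for C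
  proof (rule dense_ge)
    fix z assume z: "- (INF x\<in>C. ?I x) < z"
    from ereal_dense2[OF this] obtain b where b: "- (INF x\<in>C. ?I x) < ereal b" "ereal b < z" by blast
    \<comment> \<open>The room between \<open>a\<close> and \<open>b\<close> absorbs the factor \<open>2\<close> from the two half-lines.\<close>
    from ereal_dense2[OF b(1)] obtain a where a: "- (INF x\<in>C. ?I x) < ereal a" "a < b" by auto
    have "\<forall>\<^sub>F t in at_top. emeasure N {\<omega> \<in> space N. Y t \<omega> / t \<in> C} \<le> ennreal (exp (b * t))"
    proof (cases "0 \<le> b")
      case True
      show ?thesis using eventually_gt_at_top[of 0]
      proof eventually_elim
        case (elim t)
        have "emeasure N {\<omega> \<in> space N. Y t \<omega> / t \<in> C} \<le> 1" by (rule emeasure_le_1)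
        also have "1 \<le> ennreal (exp (b * t))"
          using elim True by (simp add: ennreal_1[symmetric] del: ennreal_1)
        finally show ?case .
      qed
    next
      case False
      have "ereal (- a) < (INF x\<in>C. ?I x)"
        using a(1) by (simp add: ereal_uminus_less_reorder)
      then have "ereal (- a) < ?I x" if "x \<in> C" for x
        using INF_lower[OF that, of ?I] by order
      then have "\<forall>\<^sub>F t in at_top. emeasure N {\<omega> \<in> space N. Y t \<omega> / t \<in> C} \<le> 2 * ennreal (exp (- (- a) * t))"
        using False a(2) by (intro closed_set_exponential_bound[OF Y nonneg growth C]) auto
      moreover have "\<forall>\<^sub>F t in at_top. 2 \<le> exp ((b - a) * t)"
        using a(2) by (intro eventually_exp_ge) simp
      ultimately show ?thesis
      proof eventually_elim
        case (elim t)
        note elim(1)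
        also have "2 * ennreal (exp (- (- a) * t)) = ennreal (2 * exp (a * t))"
          by (simp add: ennreal_mult)
        also have "\<dots> \<le> ennreal (exp ((b - a) * t) * exp (a * t))"
          using elim(2) by (intro ennreal_leI mult_right_mono) auto
        also have "exp ((b - a) * t) * exp (a * t) = exp (b * t)"
          by (simp add: exp_add[symmetric] algebra_simps)
        finally show ?case .
      qed
    qed
    then have "\<forall>\<^sub>F t in at_top. ereal (1 / t) * ln_ennreal (emeasure N {\<omega> \<in> space N. Y t \<omega> / t \<in> C}) \<le> ereal b"
      using eventually_gt_at_top[of 0] by eventually_elim (rule scaled_ln_ennreal_le)
    then have "Limsup at_top (\<lambda>t. ereal (1 / t) * ln_ennreal (emeasure N {\<omega> \<in> space N. Y t \<omega> / t \<in> C})) \<le> ereal b"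
      by (rule Limsup_bounded)
    then show "Limsup at_top (\<lambda>t. ereal (1 / t) * ln_ennreal (emeasure N {\<omega> \<in> space N. Y t \<omega> / t \<in> C})) \<le> z"
      using b(2) by order
  qed
  have lower: "- (INF x\<in>U. ?I x)
      \<le> Liminf at_top (\<lambda>t. ereal (1 / t) * ln_ennreal (emeasure N {\<omega> \<in> space N. Y t \<omega> / t \<in> U}))"
    (is "_ \<le> ?L") if U: "open U" for U
  proof -
    have "- ?L \<le> ?I x" if x: "x \<in> U" for x
    proof (cases "?I x < \<infinity>")
      case True
      obtain \<eta> y where \<eta>: "\<eta> \<in> interior (eff_domain \<Lambda>)" and y: "y \<in> U"
        and deriv: "((\<lambda>\<theta>. real_of_ereal (\<Lambda> \<theta>)) has_real_derivative y) (at \<eta>)"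
        and le: "?I y \<le> ?I x"
        using exposed_point_approximation[OF smooth nonneg zero star int0 U x True] by blast
      have "\<eta> \<in> eff_domain \<Lambda>" using \<eta> interior_subset by blast
      then obtain l where l: "\<Lambda> \<eta> = ereal l"
        using nonneg[of \<eta>] by (cases "\<Lambda> \<eta>") (auto simp: eff_domain_def)
      have ev: "\<forall>\<^sub>F \<theta> in nhds \<eta>. has_exp_growth (\<lambda>t. mgf N (Y t) \<theta>) (real_of_ereal (\<Lambda> \<theta>))"
        using eventually_nhds_in_open[OF open_interior \<eta>]
        by eventually_elim (use growth interior_subset in blast)
      have "ereal (l - \<eta> * y) \<le> ?L"
      proof (rule dense_le)
        fix z assume "z < ereal (l - \<eta> * y)"
        from ereal_dense2[OF this] obtain r where r: "z < ereal r" "r < l - \<eta> * y" by auto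
        have "\<forall>\<^sub>F t in at_top. ennreal (exp (r * t)) \<le> emeasure N {\<omega> \<in> space N. Y t \<omega> / t \<in> U}"
          using r(2) l
          by (intro exp_growth_slope_lower_bound[OF \<open>prob_space N\<close> Y deriv ev U y]) auto
        then have "\<forall>\<^sub>F t in at_top. ereal r \<le> ereal (1 / t) * ln_ennreal (emeasure N {\<omega> \<in> space N. Y t \<omega> / t \<in> U})"
          using eventually_gt_at_top[of 0] by eventually_elim (rule scaled_ln_ennreal_ge)
        then have "ereal r \<le> ?L" by (rule Liminf_bounded)
        then show "z \<le> ?L" using r(1) by order
      qed
      then have "- ?L \<le> ereal (\<eta> * y) - \<Lambda> \<eta>"
        by (cases ?L) (auto simp: l)
      also have "\<dots> \<le> ?I y" by (rule legendre_transform_ge)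
      finally show ?thesis using le by order
    qed simp
    then have "- ?L \<le> (INF x\<in>U. ?I x)" by (intro INF_greatest)
    then show ?thesis by (simp add: ereal_uminus_le_reorder)
  qed
  have "\<Lambda> \<theta> \<noteq> -\<infinity>" for \<theta> using nonneg[of \<theta>] by auto
  then show ?thesis
    unfolding satisfies_LDP_def using upper lower closed_legendre_sublevel[of \<Lambda>] I_nonneg
    by (auto intro!: filterlim_ident borel_measurable_divide Y)
qed

section \<open>Contraction of logarithmic moment generating functions\<close>

text \<open>
  Convexity of \<open>exp\<close> gives \<open>exp (p y) \<le> p exp y + (1 - p)\<close>, and a convex combination of the moment
  generating function and \<open>1\<close> is at most their maximum.
\<close>

lemma mgf_contraction:
  assumes "prob_space M" and [measurable]: "X \<in> borel_measurable M" and p: "0 \<le> p" "p \<le> 1"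
  shows "mgf M X (p * \<theta>) \<le> max (mgf M X \<theta>) 1"
proof -
  interpret prob_space M by fact
  have "mgf M X (p * \<theta>) \<le> (\<integral>\<^sup>+\<omega>. ennreal p * ennreal (exp (\<theta> * X \<omega>)) + ennreal (1 - p) \<partial>M)"
    unfolding mgf_def
  proof (rule nn_integral_mono)
    fix \<omega>
    have "exp (p * (\<theta> * X \<omega>)) \<le> p * exp (\<theta> * X \<omega>) + (1 - p)"
      using convex_onD[OF exp_convex p, of 0 "\<theta> * X \<omega>"] by simp
    then have "ennreal (exp (p * \<theta> * X \<omega>)) \<le> ennreal (p * exp (\<theta> * X \<omega>) + (1 - p))"
      by (intro ennreal_leI) (simp add: mult.assoc)
    then show "ennreal (exp (p * \<theta> * X \<omega>)) \<le> ennreal p * ennreal (exp (\<theta> * X \<omega>)) + ennreal (1 - p)"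
      using p by (simp add: ennreal_plus ennreal_mult)
  qed
  also have "\<dots> = ennreal p * mgf M X \<theta> + ennreal (1 - p)"
    unfolding mgf_def by (simp add: nn_integral_add nn_integral_cmult emeasure_space_1)
  also have "\<dots> \<le> ennreal p * max (mgf M X \<theta>) 1 + ennreal (1 - p) * max (mgf M X \<theta>) 1"
    using mult_left_mono[of 1 "max (mgf M X \<theta>) 1" "ennreal (1 - p)"]
    by (intro add_mono mult_left_mono) auto
  also have "\<dots> = (ennreal p + ennreal (1 - p)) * max (mgf M X \<theta>) 1"
    by (simp add: distrib_right)
  also have "ennreal p + ennreal (1 - p) = 1"
    using p by (simp add: ennreal_plus[symmetric] del: ennreal_plus)
  finally show ?thesis by simp
qed

lemma ln_ennreal_mono:
  assumes "x \<le> y"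
  shows "ln_ennreal x \<le> ln_ennreal y"
proof (cases "x = 0 \<or> y = \<infinity>")
  case True
  then show ?thesis by (auto simp: ln_ennreal_def)
next
  case False
  then have "y \<noteq> 0" "x \<noteq> \<infinity>" using assms by (auto simp: top_unique)
  then have "0 < enn2real x" "enn2real x \<le> enn2real y"
    using False assms by (auto simp: enn2real_positive_iff less_top zero_less_iff_neq_zero intro: enn2real_mono)
  then show ?thesis using False \<open>y \<noteq> 0\<close> \<open>x \<noteq> \<infinity>\<close> by (simp add: ln_ennreal_def)
qed

lemma ln_ennreal_eq_ereal_iff: "ln_ennreal x = ereal k \<longleftrightarrow> x = ennreal (exp k)"
  by (cases x) (auto simp: ln_ennreal_def)

lemma log_mgf_eq_mgf: "log_mgf M X \<theta> = ln_ennreal (mgf M X \<theta>)"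
  by (simp add: log_mgf_def mgf_def)

lemma Lambda_fun_nonneg: "0 \<le> Lambda_fun \<nu> \<kappa> \<theta>"
  by (simp add: Lambda_fun_def)

text \<open>
  The maximum with \<open>0\<close> is harmless because \<^const>\<open>Lambda_fun\<close> vanishes where \<open>\<kappa>\<close> is negative.
\<close>

lemma Lambda_fun_mono:
  assumes "0 < \<nu>" and "\<kappa> \<theta> \<le> max (\<kappa> \<theta>') 0"
  shows "Lambda_fun \<nu> \<kappa> \<theta> \<le> Lambda_fun \<nu> \<kappa> \<theta>'"
proof (cases "0 < \<kappa> \<theta>")
  case False
  then show ?thesis by (auto simp: Lambda_fun_def less_le)
next
  case True
  then have "\<kappa> \<theta> \<le> \<kappa> \<theta>'" using assms(2) by (auto simp: max_def split: if_splits)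
  then show ?thesis using True assms(1)
    by (cases "\<kappa> \<theta>"; cases "\<kappa> \<theta>'") (auto simp: Lambda_fun_def intro!: powr_mono2)
qed

lemma Lambda_fun_log_mgf_contraction:
  assumes "prob_space M" "X \<in> borel_measurable M" "0 < \<nu>" "0 \<le> p" "p \<le> 1"
  shows "Lambda_fun \<nu> (log_mgf M X) (p * \<theta>) \<le> Lambda_fun \<nu> (log_mgf M X) \<theta>"
proof (rule Lambda_fun_mono[OF \<open>0 < \<nu>\<close>])
  have "log_mgf M X (p * \<theta>) \<le> ln_ennreal (max (mgf M X \<theta>) 1)"
    unfolding log_mgf_eq_mgf by (intro ln_ennreal_mono mgf_contraction assms)
  also have "\<dots> = max (log_mgf M X \<theta>) 0"
  proof -
    have "ln_ennreal 1 = 0" by (simp add: ln_ennreal_def)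
    then show ?thesis unfolding log_mgf_eq_mgf
      by (metis ln_ennreal_mono max_def linear order.antisym)
  qed
  finally show "log_mgf M X (p * \<theta>) \<le> max (log_mgf M X \<theta>) 0" .
qed

section \<open>Levy processes at independent random times\<close>

text \<open>
  The first multiple of \<open>1 / (n + 1)\<close> strictly to the right of \<open>u\<close>.  It takes only countably many
  values, all rational, and the value of a right-continuous path at \<open>u\<close> is the limit of its values at
  these points.
\<close>

definition right_approx :: "nat \<Rightarrow> real \<Rightarrow> real" where
  "right_approx n u = (of_int \<lfloor>real (Suc n) * u\<rfloor> + 1) / real (Suc n)"

lemma right_approx_bounds:
  "u < right_approx n u" "right_approx n u \<le> u + 1 / real (Suc n)"
proof -
  define N where "N = real (Suc n)"
  have N: "0 < N" and r: "right_approx n u = (of_int \<lfloor>N * u\<rfloor> + 1) / N"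
    by (simp_all add: N_def right_approx_def)
  have "u * N < of_int \<lfloor>N * u\<rfloor> + 1" by (simp add: mult.commute)
  then show "u < right_approx n u" unfolding r using N by (simp add: pos_less_divide_eq)
  have "(of_int \<lfloor>N * u\<rfloor> + 1) / N \<le> (N * u + 1) / N"
    using N by (intro divide_right_mono add_right_mono of_int_floor_le) simp
  also have "\<dots> = u + 1 / N" using N by (simp add: field_simps)
  finally show "right_approx n u \<le> u + 1 / real (Suc n)" unfolding r N_def .
qed

lemma filterlim_right_approx: "filterlim (\<lambda>n. right_approx n u) (at_right u) sequentially"
proof -
  have "(\<lambda>n. u + 1 / real (Suc n)) \<longlonglongrightarrow> u + 0"
    by (intro tendsto_add tendsto_const LIMSEQ_Suc[OF lim_const_over_n])
  then have "(\<lambda>n. right_approx n u) \<longlonglongrightarrow> u"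
    by (intro tendsto_sandwich[of "\<lambda>_. u" "\<lambda>n. right_approx n u" _ "\<lambda>n. u + 1 / real (Suc n)"]
        always_eventually allI less_imp_le[OF right_approx_bounds(1)] right_approx_bounds(2)) simp_all
  then show ?thesis
    by (rule tendsto_imp_filterlim_at_right) (simp add: right_approx_bounds)
qed

lemma cadlag_right_approx:
  assumes "cadlag f" "0 \<le> u"
  shows "(\<lambda>n. f (right_approx n u)) \<longlonglongrightarrow> f u"
proof -
  have "(f \<longlongrightarrow> f u) (at_right u)"
    using assms by (simp add: cadlag_def continuous_within)
  then show ?thesis using filterlim_right_approx by (rule filterlim_compose)
qed

text \<open>
  The increments over \<open>[0, s]\<close> and \<open>[s, s + h]\<close> are independent, and the second is distributed as
  \<open>X h\<close>.
\<close>

lemma levy_mgf_add: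
  assumes "levy_process M X" "0 \<le> s" "0 \<le> h"
  shows "mgf M (X (s + h)) \<theta> = mgf M (X s) \<theta> * mgf M (X h) \<theta>"
proof -
  interpret prob_space M using assms(1) by (simp add: levy_process_def)
  have meas: "X t \<in> borel_measurable M" if "0 \<le> t" for t
    using assms(1) that by (simp add: levy_process_def)
  have zero: "AE \<omega> in M. X 0 \<omega> = 0" using assms(1) by (simp add: levy_process_def)
  have [measurable]: "X s \<in> borel_measurable M" "X h \<in> borel_measurable M"
    "X (s + h) \<in> borel_measurable M" "X 0 \<in> borel_measurable M"
    using meas assms by auto
  define \<tau> where "\<tau> i = (if i = 0 then 0 else if i = 1 then s else s + h)" for i :: nat
  have "0 \<le> \<tau> 0 \<and> (\<forall>i<2. \<tau> i \<le> \<tau> (Suc i))"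
    using assms by (auto simp: \<tau>_def less_2_cases_iff)
  then have "indep_vars (\<lambda>_. borel) (\<lambda>i \<omega>. X (\<tau> (Suc i)) \<omega> - X (\<tau> i) \<omega>) {..<2}"
    using assms(1) unfolding levy_process_def by blast
  then have "indep_vars (\<lambda>_. borel)
      (\<lambda>i \<omega>. ennreal (exp (\<theta> * (X (\<tau> (Suc i)) \<omega> - X (\<tau> i) \<omega>)))) {..<2}"
    by (rule indep_vars_compose2) measurable
  then have "(\<integral>\<^sup>+\<omega>. (\<Prod>i<2. ennreal (exp (\<theta> * (X (\<tau> (Suc i)) \<omega> - X (\<tau> i) \<omega>)))) \<partial>M)
      = (\<Prod>i<2. \<integral>\<^sup>+\<omega>. ennreal (exp (\<theta> * (X (\<tau> (Suc i)) \<omega> - X (\<tau> i) \<omega>))) \<partial>M)"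
    by (intro indep_vars_nn_integral) auto
  then have "(\<integral>\<^sup>+\<omega>. ennreal (exp (\<theta> * (X s \<omega> - X 0 \<omega>))) * ennreal (exp (\<theta> * (X (s + h) \<omega> - X s \<omega>))) \<partial>M)
      = (\<integral>\<^sup>+\<omega>. ennreal (exp (\<theta> * (X s \<omega> - X 0 \<omega>))) \<partial>M) *
        (\<integral>\<^sup>+\<omega>. ennreal (exp (\<theta> * (X (s + h) \<omega> - X s \<omega>))) \<partial>M)"
    by (simp add: numeral_2_eq_2 \<tau>_def)
  moreover have "(\<integral>\<^sup>+\<omega>. ennreal (exp (\<theta> * (X s \<omega> - X 0 \<omega>))) * ennreal (exp (\<theta> * (X (s + h) \<omega> - X s \<omega>))) \<partial>M)
      = mgf M (X (s + h)) \<theta>"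
    unfolding mgf_def using zero
    by (intro nn_integral_cong_AE, eventually_elim)
      (simp add: ennreal_mult[symmetric] exp_add[symmetric] algebra_simps)
  moreover have "(\<integral>\<^sup>+\<omega>. ennreal (exp (\<theta> * (X u \<omega> - X 0 \<omega>))) \<partial>M) = mgf M (X u) \<theta>" for u
    unfolding mgf_def using zero by (intro nn_integral_cong_AE, eventually_elim) simp
  moreover have "(\<integral>\<^sup>+\<omega>. ennreal (exp (\<theta> * (X (s + h) \<omega> - X s \<omega>))) \<partial>M)
      = (\<integral>\<^sup>+y. ennreal (exp (\<theta> * y)) \<partial>distr M borel (\<lambda>\<omega>. X (s + h) \<omega> - X s \<omega>))"
    by (subst nn_integral_distr) auto
  moreover have "distr M borel (\<lambda>\<omega>. X (s + h) \<omega> - X s \<omega>) = distr M borel (\<lambda>\<omega>. X h \<omega> - X 0 \<omega>)"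
    using assms by (simp add: levy_process_def)
  moreover have "(\<integral>\<^sup>+y. ennreal (exp (\<theta> * y)) \<partial>distr M borel (\<lambda>\<omega>. X h \<omega> - X 0 \<omega>))
      = (\<integral>\<^sup>+\<omega>. ennreal (exp (\<theta> * (X h \<omega> - X 0 \<omega>))) \<partial>M)"
    by (subst nn_integral_distr) auto
  ultimately show ?thesis by simp
qed

text \<open>
  Multiplicativity fixes the value at positive rational times.  At a real time \<open>u\<close>, Fatou's lemma along
  rational times decreasing to \<open>u\<close> gives only the upper bound, as no domination is available.
  The lower bound follows from the upper one at \<open>v - u\<close>, for a rational \<open>v > u\<close>, since the values at
  \<open>u\<close> and \<open>v - u\<close> multiply to the known value at \<open>v\<close>.
\<close>

lemma levy_mgf:
  assumes levy: "levy_process M X" and k: "mgf M (X 1) \<theta> = ennreal (exp k)" and "0 \<le> u"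
  shows "mgf M (X u) \<theta> = ennreal (exp (k * u))"
proof -
  interpret prob_space M using levy by (simp add: levy_process_def)
  have [measurable]: "X t \<in> borel_measurable M" if "0 \<le> t" for t
    using levy that by (simp add: levy_process_def)
  define \<phi> where "\<phi> u = mgf M (X u) \<theta>" for u
  have add: "\<phi> (s + h) = \<phi> s * \<phi> h" if "0 \<le> s" "0 \<le> h" for s h
    unfolding \<phi>_def by (rule levy_mgf_add[OF levy that])
  have "\<phi> 0 = (\<integral>\<^sup>+\<omega>. 1 \<partial>M)"
  proof -
    have "AE \<omega> in M. X 0 \<omega> = 0" using levy by (simp add: levy_process_def)
    then show ?thesis unfolding \<phi>_def mgf_def
      by (intro nn_integral_cong_AE, eventually_elim) simp
  qed
  then have "\<phi> 0 = 1" by (simp add: emeasure_space_1)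
  have mult: "\<phi> (real n * h) = \<phi> h ^ n" if "0 \<le> h" for n h
  proof (induction n)
    case (Suc n)
    have "\<phi> (real (Suc n) * h) = \<phi> (h + real n * h)" by (simp add: algebra_simps)
    also have "\<dots> = \<phi> h * \<phi> (real n * h)" using that by (intro add) auto
    finally show ?case using Suc by simp
  qed (simp add: \<open>\<phi> 0 = 1\<close>)
  have unit_fraction: "\<phi> (1 / real (Suc n)) = ennreal (exp (k / real (Suc n)))" for n
  proof -
    have pow: "\<phi> (1 / real (Suc n)) ^ Suc n = ennreal (exp k)"
      using mult[of "1 / real (Suc n)" "Suc n"] k by (simp add: \<phi>_def del: of_nat_Suc power_Suc)
    then have "\<phi> (1 / real (Suc n)) \<noteq> top" by (auto simp: ennreal_top_mult power_Suc2)
    then obtain q where q: "\<phi> (1 / real (Suc n)) = ennreal q" "q \<ge> 0"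
      by (cases "\<phi> (1 / real (Suc n))") auto
    then have "ennreal (q ^ Suc n) = ennreal (exp k)" using pow by (simp add: ennreal_power del: power_Suc)
    then have "q ^ Suc n = exp k" using q(2) by (simp add: ennreal_inj del: power_Suc)
    also have "\<dots> = exp (k / real (Suc n)) ^ Suc n"
      by (simp add: exp_of_nat_mult[symmetric] del: power_Suc of_nat_Suc)
    finally have "q = exp (k / real (Suc n))"
      using q(2) by (intro power_eq_imp_eq_base[of q "Suc n"]) auto
    then show ?thesis using q by simp
  qed
  have rational: "\<phi> (right_approx n u) = ennreal (exp (k * right_approx n u))" if "0 \<le> u" for n u
  proof -
    define m where "m = nat (\<lfloor>real (Suc n) * u\<rfloor> + 1)"
    have m: "right_approx n u = real m * (1 / real (Suc n))"
      using that by (simp add: right_approx_def m_def)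
    have "\<phi> (right_approx n u) = ennreal (exp (k / real (Suc n))) ^ m"
      unfolding m by (subst mult) (simp_all only: unit_fraction, simp)
    also have "\<dots> = ennreal (exp (k / real (Suc n)) ^ m)" by (simp add: ennreal_power)
    also have "exp (k / real (Suc n)) ^ m = exp (k * right_approx n u)"
      unfolding m by (simp add: exp_of_nat_mult[symmetric] algebra_simps)
    finally show ?thesis .
  qed
  have cadlag: "AE \<omega> in M. cadlag (\<lambda>t. X t \<omega>)" using levy by (simp add: levy_process_def)
  have upper: "\<phi> u \<le> ennreal (exp (k * u))" if "0 \<le> u" for u
  proof -
    have pos: "0 \<le> right_approx n u" for n using right_approx_bounds(1)[of u n] that by linarith
    have "\<phi> u = (\<integral>\<^sup>+\<omega>. liminf (\<lambda>n. ennreal (exp (\<theta> * X (right_approx n u) \<omega>))) \<partial>M)"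
      unfolding \<phi>_def mgf_def using cadlag
    proof (intro nn_integral_cong_AE, eventually_elim)
      case (elim \<omega>)
      have "(\<lambda>n. ennreal (exp (\<theta> * X (right_approx n u) \<omega>))) \<longlonglongrightarrow> ennreal (exp (\<theta> * X u \<omega>))"
        by (intro tendsto_ennrealI tendsto_intros cadlag_right_approx[OF _ that] elim)
      then show ?case by (intro lim_imp_Liminf[symmetric]) auto
    qed
    also have "\<dots> \<le> liminf (\<lambda>n. \<phi> (right_approx n u))"
      unfolding \<phi>_def mgf_def by (intro nn_integral_liminf) (use pos in measurable)
    also have "\<dots> = ennreal (exp (k * u))"
    proof (rule lim_imp_Liminf)
      have "(\<lambda>n. right_approx n u) \<longlonglongrightarrow> u"
        using filterlim_right_approx[of u] by (simp add: filterlim_at)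
      then show "(\<lambda>n. \<phi> (right_approx n u)) \<longlonglongrightarrow> ennreal (exp (k * u))"
        unfolding rational[OF that] by (intro tendsto_ennrealI tendsto_intros)
    qed simp
    finally show ?thesis .
  qed
  have lower: "ennreal (exp (k * u)) \<le> \<phi> u"
  proof -
    define v where "v = right_approx 0 u"
    have v: "u < v" using right_approx_bounds(1) by (simp add: v_def)
    have "ennreal (exp (k * v)) = \<phi> (u + (v - u))"
      using rational[OF \<open>0 \<le> u\<close>, of 0] by (simp add: v_def)
    also have "\<dots> = \<phi> u * \<phi> (v - u)" using v \<open>0 \<le> u\<close> by (intro add) auto
    also have "\<dots> \<le> \<phi> u * ennreal (exp (k * (v - u)))"
      using v by (intro mult_left_mono upper) auto
    finally have le: "ennreal (exp (k * v)) \<le> \<phi> u * ennreal (exp (k * (v - u)))" .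
    have "ennreal (exp (k * u)) = ennreal (exp (k * v)) * ennreal (exp (- (k * (v - u))))"
      by (simp add: ennreal_mult[symmetric] exp_add[symmetric] algebra_simps)
    also have "\<dots> \<le> \<phi> u * ennreal (exp (k * (v - u))) * ennreal (exp (- (k * (v - u))))"
      using le by (rule mult_right_mono) simp
    also have "\<dots> = \<phi> u * (ennreal (exp (k * (v - u))) * ennreal (exp (- (k * (v - u)))))"
      by (simp only: mult.assoc)
    also have "ennreal (exp (k * (v - u))) * ennreal (exp (- (k * (v - u)))) = 1"
      by (simp add: ennreal_mult[symmetric] exp_add[symmetric])
    finally show ?thesis by simp
  qed
  show ?thesis using upper[OF \<open>0 \<le> u\<close>] lower unfolding \<phi>_def by (rule antisym)
qed

text \<open>
  A jointly measurable version of \<open>(x, u) \<mapsto> x u\<close> on right-continuous paths.  Evaluation itself is not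
  measurable on the product space over uncountably many times.
\<close>

definition path_eval :: "(real \<Rightarrow> real) \<times> real \<Rightarrow> real" where
  "path_eval = (\<lambda>(x, u). lim (\<lambda>n. x (right_approx n (max 0 u))))"

text \<open>
  At a fixed level of the approximation only countably many times occur, so evaluation there is
  measurable piece by piece.
\<close>

lemma measurable_path_eval [measurable]:
  "path_eval \<in> borel_measurable (Pi\<^sub>M {0..} (\<lambda>_. borel) \<Otimes>\<^sub>M borel)"
proof -
  have "(\<lambda>xu. fst xu (right_approx n (max 0 (snd xu)))) \<in>
      borel_measurable (Pi\<^sub>M {0..} (\<lambda>_. borel :: real measure) \<Otimes>\<^sub>M (borel :: real measure))" for n
  proof -
    define q where "q j = (real j + 1) / real (Suc n)" for j :: nat
    have "(\<lambda>xu. fst xu (q (nat \<lfloor>real (Suc n) * max 0 (snd xu)\<rfloor>))) \<in>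
      borel_measurable (Pi\<^sub>M {0..} (\<lambda>_. borel :: real measure) \<Otimes>\<^sub>M (borel :: real measure))"
    proof (rule measurable_compose_countable'[where f = "\<lambda>j xu. fst xu (q j)" and I = UNIV])
      fix j :: nat
      have "q j \<in> {0..}" by (simp add: q_def)
      then show "(\<lambda>xu. fst xu (q j)) \<in> borel_measurable (Pi\<^sub>M {0..} (\<lambda>_. borel :: real measure) \<Otimes>\<^sub>M (borel :: real measure))"
        by measurable
    next
      have [measurable]: "nat \<in> count_space UNIV \<rightarrow>\<^sub>M count_space UNIV" by simp
      show "(\<lambda>xu. nat \<lfloor>real (Suc n) * max 0 (snd xu)\<rfloor>) \<in>
        (Pi\<^sub>M {0..} (\<lambda>_. borel :: real measure) \<Otimes>\<^sub>M (borel :: real measure)) \<rightarrow>\<^sub>M count_space UNIV"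
        by measurable
    qed auto
    moreover have "q (nat \<lfloor>real (Suc n) * max 0 u\<rfloor>) = right_approx n (max 0 u)" for u
      by (simp add: q_def right_approx_def)
    ultimately show ?thesis by simp
  qed
  then show ?thesis unfolding path_eval_def split_beta' by measurable
qed

lemma path_eval_cadlag:
  assumes "cadlag x" "0 \<le> u"
  shows "path_eval (\<lambda>t\<in>{0..}. x t, u) = x u"
proof -
  have "0 \<le> right_approx n u" for n using right_approx_bounds(1)[of u n] assms by linarith
  then have "(\<lambda>n. (\<lambda>t\<in>{0..}. x t) (right_approx n (max 0 u))) = (\<lambda>n. x (right_approx n u))"
    using assms(2) by simp
  then show ?thesis using limI[OF cadlag_right_approx[OF assms]] by (simp add: path_eval_def)
qed

lemma AE_completion_measurable:
  fixes f g :: "'a \<Rightarrow> real"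
  assumes f: "f \<in> borel_measurable (completion M)" and eq: "AE \<omega> in M. f \<omega> = g \<omega>"
  shows "g \<in> borel_measurable (completion M)"
proof (rule measurableI)
  fix A :: "real set" assume "A \<in> sets borel"
  show "g -` A \<inter> space (completion M) \<in> sets (completion M)"
  proof (rule completion.in_sets_AE)
    show "f -` A \<inter> space (completion M) \<in> sets (completion M)"
      using f \<open>A \<in> sets borel\<close> by (rule measurable_sets)
    show "AE \<omega> in completion M. \<omega> \<in> f -` A \<inter> space (completion M) \<longleftrightarrow> \<omega> \<in> g -` A \<inter> space (completion M)"
      using AE_completion[OF eq] by eventually_elim auto
  qed auto
qed simp

lemma measurable_process_at_random_time:
  assumes X: "(\<lambda>\<omega>. \<lambda>t\<in>{0..}. X t \<omega>) \<in> completion M \<rightarrow>\<^sub>M Pi\<^sub>M {0..} (\<lambda>_. borel)"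
    and T: "T \<in> borel_measurable (completion M)"
    and cadlag: "AE \<omega> in M. cadlag (\<lambda>t. X t \<omega>)" and T_nonneg: "AE \<omega> in M. 0 \<le> T \<omega>"
  shows "(\<lambda>\<omega>. X (T \<omega>) \<omega>) \<in> borel_measurable (completion M)"
proof (rule AE_completion_measurable)
  show "(\<lambda>\<omega>. path_eval (\<lambda>t\<in>{0..}. X t \<omega>, T \<omega>)) \<in> borel_measurable (completion M)"
    using X T by measurable
  show "AE \<omega> in M. path_eval (\<lambda>t\<in>{0..}. X t \<omega>, T \<omega>) = X (T \<omega>) \<omega>"
    using cadlag T_nonneg by eventually_elim (rule path_eval_cadlag)
qed

text \<open>
  Independence makes the joint law of the two paths a product measure.  Once the process at the random
  time is written as a measurable function of the two paths, this is Tonelli's theorem.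
\<close>

lemma nn_integral_process_at_independent_time:
  fixes X Y :: "real \<Rightarrow> 'a \<Rightarrow> real" and h :: "real \<Rightarrow> ennreal"
  assumes "prob_space N" and indep: "indep_processes N X Y" and t: "0 \<le> t"
    and cadlag: "AE \<omega> in N. cadlag (\<lambda>u. X u \<omega>)" and nonneg: "AE \<omega> in N. 0 \<le> Y t \<omega>"
    and h [measurable]: "h \<in> borel_measurable borel"
  shows "(\<integral>\<^sup>+\<omega>. h (X (Y t \<omega>) \<omega>) \<partial>N) = (\<integral>\<^sup>+\<omega>. (\<integral>\<^sup>+\<omega>'. h (X (Y t \<omega>) \<omega>') \<partial>N) \<partial>N)"
proof -
  interpret prob_space N by fact
  let ?P = "Pi\<^sub>M {0..} (\<lambda>_. borel) :: (real \<Rightarrow> real) measure"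
  let ?X = "\<lambda>\<omega>. \<lambda>u\<in>{0..}. X u \<omega>" and ?Y = "\<lambda>\<omega>. \<lambda>u\<in>{0..}. Y u \<omega>"
  define F where "F xy = h (path_eval (fst xy, snd xy t))" for xy :: "(real \<Rightarrow> real) \<times> (real \<Rightarrow> real)"
  have t_index: "t \<in> {0..}" using t by simp
  have F [measurable]: "F \<in> borel_measurable (?P \<Otimes>\<^sub>M ?P)"
    unfolding F_def using t_index by measurable
  have X [measurable]: "?X \<in> N \<rightarrow>\<^sub>M ?P" and Y [measurable]: "?Y \<in> N \<rightarrow>\<^sub>M ?P"
    and joint: "distr N ?P ?X \<Otimes>\<^sub>M distr N ?P ?Y = distr N (?P \<Otimes>\<^sub>M ?P) (\<lambda>\<omega>. (?X \<omega>, ?Y \<omega>))"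
    using indep unfolding indep_processes_def indep_var_distribution_eq by auto
  interpret X: prob_space "distr N ?P ?X" by (rule prob_space_distr[OF X])
  interpret Y: prob_space "distr N ?P ?Y" by (rule prob_space_distr[OF Y])
  interpret XY: pair_prob_space "distr N ?P ?X" "distr N ?P ?Y" ..
  have F_path: "F (?X \<omega>', ?Y \<omega>) = h (X (Y t \<omega>) \<omega>')"
    if "cadlag (\<lambda>u. X u \<omega>')" "0 \<le> Y t \<omega>" for \<omega> \<omega>'
    using path_eval_cadlag[OF that] t by (simp add: F_def)
  have "(\<integral>\<^sup>+\<omega>. h (X (Y t \<omega>) \<omega>) \<partial>N) = (\<integral>\<^sup>+\<omega>. F (?X \<omega>, ?Y \<omega>) \<partial>N)"
    using cadlag nonneg by (intro nn_integral_cong_AE, eventually_elim) (simp only: F_path)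
  also have "\<dots> = (\<integral>\<^sup>+xy. F xy \<partial>distr N (?P \<Otimes>\<^sub>M ?P) (\<lambda>\<omega>. (?X \<omega>, ?Y \<omega>)))"
    by (rule nn_integral_distr[symmetric]) measurable
  also have "\<dots> = (\<integral>\<^sup>+y. (\<integral>\<^sup>+x. F (x, y) \<partial>distr N ?P ?X) \<partial>distr N ?P ?Y)"
    unfolding joint[symmetric] by (rule XY.nn_integral_snd[symmetric]) measurable
  also have "\<dots> = (\<integral>\<^sup>+\<omega>. (\<integral>\<^sup>+x. F (x, ?Y \<omega>) \<partial>distr N ?P ?X) \<partial>N)"
    by (rule nn_integral_distr) measurable
  also have "\<dots> = (\<integral>\<^sup>+\<omega>. (\<integral>\<^sup>+\<omega>'. F (?X \<omega>', ?Y \<omega>) \<partial>N) \<partial>N)"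
    by (intro nn_integral_cong nn_integral_distr X measurable_Pair2[OF F])
      (use measurable_space[OF Y] in auto)
  also have "\<dots> = (\<integral>\<^sup>+\<omega>. (\<integral>\<^sup>+\<omega>'. h (X (Y t \<omega>) \<omega>') \<partial>N) \<partial>N)"
    using nonneg
  proof (intro nn_integral_cong_AE, eventually_elim)
    case (elim \<omega>)
    show ?case using cadlag
      by (intro nn_integral_cong_AE, eventually_elim) (simp only: F_path elim)
  qed
  finally show ?thesis .
qed

section \<open>Exponential moments of the inverse stable subordinator\<close>

lemma stable_subordinator_mgf:
  assumes "stable_subordinator M \<nu> H" "0 \<le> u" "0 \<le> \<xi>"
  shows "mgf M (H u) (- \<xi>) = ennreal (exp (- u * \<xi> powr \<nu>))"
proof -
  have E: "(\<integral>\<omega>. exp (- \<xi> * H u \<omega>) \<partial>M) = exp (- u * \<xi> powr \<nu>)"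
    using assms by (simp add: stable_subordinator_def)
  then have "integrable M (\<lambda>\<omega>. exp (- \<xi> * H u \<omega>))"
    using not_integrable_integral_eq by fastforce
  then show ?thesis unfolding mgf_def E[symmetric] by (intro nn_integral_eq_integral) auto
qed

lemma stable_subordinator_small_ball:
  assumes H: "stable_subordinator M \<nu> H" and "0 \<le> u" "0 \<le> \<xi>"
  shows "emeasure M {\<omega> \<in> space M. H u \<omega> \<le> t} \<le> ennreal (exp (\<xi> * t - u * \<xi> powr \<nu>))"
proof -
  have [measurable]: "H u \<in> borel_measurable M"
    using assms by (simp add: stable_subordinator_def levy_process_def)
  have "emeasure M {\<omega> \<in> space M. H u \<omega> \<le> t} \<le> emeasure M {\<omega> \<in> space M. - \<xi> * t \<le> - \<xi> * H u \<omega>}"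
    using \<open>0 \<le> \<xi>\<close> by (intro emeasure_mono Collect_mono) (auto intro: mult_left_mono)
  also have "\<dots> \<le> ennreal (exp (- (- \<xi> * t))) * mgf M (H u) (- \<xi>)"
    by (rule chernoff_bound) measurable
  also have "\<dots> = ennreal (exp (\<xi> * t - u * \<xi> powr \<nu>))"
    unfolding stable_subordinator_mgf[OF assms]
    by (simp add: ennreal_mult[symmetric] exp_add[symmetric])
  finally show ?thesis .
qed

text \<open>
  The event that \<open>H\<close> stays below \<open>t\<close> at all integer times has probability at most \<open>exp (t - n)\<close> for
  every \<open>n\<close>, by the preceding bound with \<open>\<xi> = 1\<close>.
\<close>

lemma stable_subordinator_unbounded:
  assumes H: "stable_subordinator M \<nu> H"
  shows "AE \<omega> in M. \<exists>u\<ge>0. t < H u \<omega>"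
proof -
  interpret prob_space M using H by (simp add: stable_subordinator_def levy_process_def)
  have [measurable]: "H (real n) \<in> borel_measurable M" for n
    using H by (simp add: stable_subordinator_def levy_process_def)
  define E where "E = {\<omega> \<in> space M. \<forall>n. H (real n) \<omega> \<le> t}"
  have [measurable]: "E \<in> sets M" unfolding E_def by measurable
  have "measure M E \<le> exp t * exp (- 1) ^ n" for n
  proof -
    have "emeasure M E \<le> emeasure M {\<omega> \<in> space M. H (real n) \<omega> \<le> t}"
      by (intro emeasure_mono) (auto simp: E_def)
    also have "\<dots> \<le> ennreal (exp (1 * t - real n * 1 powr \<nu>))"
      by (rule stable_subordinator_small_ball[OF H]) auto
    also have "exp (1 * t - real n * 1 powr \<nu>) = exp t * exp (- 1) ^ n"
      by (simp add: exp_of_nat_mult[symmetric] exp_add[symmetric])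
    finally show ?thesis by (simp add: emeasure_eq_measure)
  qed
  moreover have "(\<lambda>n. exp t * exp (- 1 :: real) ^ n) \<longlonglongrightarrow> exp t * 0"
    by (intro tendsto_mult tendsto_const LIMSEQ_power_zero) simp
  ultimately have "measure M E \<le> 0"
    by (intro LIMSEQ_le_const[of "\<lambda>n. exp t * exp (- 1) ^ n"]) auto
  then have "E \<in> null_sets M" by (auto simp: emeasure_eq_measure measure_le_0_iff)
  then have "AE \<omega> in M. \<omega> \<notin> E" by (rule AE_not_in)
  then show ?thesis
  proof (rule AE_mp, intro AE_I2 impI)
    fix \<omega> assume "\<omega> \<in> space M" "\<omega> \<notin> E"
    then obtain n where "t < H (real n) \<omega>" by (auto simp: E_def not_le)
    then show "\<exists>u\<ge>0. t < H u \<omega>" by (intro exI[of _ "real n"]) auto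
  qed
qed

text \<open>
  At \<open>u = L t\<close> the value \<open>H u\<close> may be equal to \<open>t\<close> or exceed it, so neither implication is an
  equivalence.  The first one bounds the tails of \<open>L\<close> from above, the second one from below.
\<close>

lemma first_passage_duality:
  assumes H: "stable_subordinator M \<nu> H"
    and L: "AE \<omega> in M. \<forall>t\<ge>0. L t \<omega> = Inf {u. 0 \<le> u \<and> H u \<omega> > t}" and t: "0 \<le> t"
  shows "AE \<omega> in M. 0 \<le> L t \<omega> \<and>
    (\<forall>u\<ge>0. (u < L t \<omega> \<longrightarrow> H u \<omega> \<le> t) \<and> (H u \<omega> \<le> t \<longrightarrow> u \<le> L t \<omega>))"
proof -
  have "AE \<omega> in M. mono_on {0..} (\<lambda>u. H u \<omega>)" using H by (simp add: stable_subordinator_def)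
  then show ?thesis using L stable_subordinator_unbounded[OF H, of t]
  proof eventually_elim
    case (elim \<omega>)
    let ?A = "{u. 0 \<le> u \<and> t < H u \<omega>}"
    have L_Inf: "L t \<omega> = Inf ?A" using elim(2) t by simp
    have bdd: "bdd_below ?A" by (rule bdd_belowI[of _ 0]) simp
    have ne: "?A \<noteq> {}" using elim(3) by blast
    have "0 \<le> L t \<omega>" unfolding L_Inf using ne by (intro cInf_greatest) auto
    moreover have "H u \<omega> \<le> t" if "0 \<le> u" "u < L t \<omega>" for u
    proof (rule ccontr)
      assume "\<not> H u \<omega> \<le> t"
      then have "L t \<omega> \<le> u" unfolding L_Inf using that(1) by (intro cInf_lower bdd) auto
      then show False using that(2) by simp
    qed
    moreover have "u \<le> L t \<omega>" if "0 \<le> u" "H u \<omega> \<le> t" for u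
      unfolding L_Inf
    proof (rule cInf_greatest[OF ne])
      fix v assume v: "v \<in> ?A"
      show "u \<le> v"
      proof (rule ccontr)
        assume "\<not> u \<le> v"
        then have "H v \<omega> \<le> H u \<omega>" using v that elim(1) by (auto simp: mono_on_def)
        then show False using v that by simp
      qed
    qed
    ultimately show ?case by blast
  qed
qed

context
  fixes M :: "'a measure" and \<nu> :: real and H L :: "real \<Rightarrow> 'a \<Rightarrow> real"
  assumes prob: "prob_space M" and \<nu>: "0 < \<nu>" "\<nu> < 1"
    and H: "stable_subordinator M \<nu> H"
    and L: "AE \<omega> in M. \<forall>t\<ge>0. L t \<omega> = Inf {u. 0 \<le> u \<and> H u \<omega> > t}"
    and L_meas: "\<And>t. 0 \<le> t \<Longrightarrow> L t \<in> borel_measurable (completion M)"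
begin

interpretation prob_space M by (fact prob)

interpretation completion: prob_space "completion M" by (rule prob_space_completion)

lemma H_meas: "0 \<le> u \<Longrightarrow> H u \<in> borel_measurable M"
  using H by (simp add: stable_subordinator_def levy_process_def)

lemma inverse_subordinator_tail:
  assumes "0 \<le> t" "0 \<le> u" "0 \<le> \<xi>"
  shows "emeasure (completion M) {\<omega> \<in> space M. u < L t \<omega>} \<le> ennreal (exp (\<xi> * t - u * \<xi> powr \<nu>))"
proof -
  have [measurable]: "H u \<in> borel_measurable M" using H_meas assms by simp
  have "emeasure (completion M) {\<omega> \<in> space M. u < L t \<omega>} \<le> emeasure (completion M) {\<omega> \<in> space M. H u \<omega> \<le> t}"
  proof (rule emeasure_mono_AE)
    show "AE \<omega> in completion M. \<omega> \<in> {\<omega> \<in> space M. u < L t \<omega>} \<longrightarrow> \<omega> \<in> {\<omega> \<in> space M. H u \<omega> \<le> t}"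
      using AE_completion[OF first_passage_duality[OF H L \<open>0 \<le> t\<close>]]
      by eventually_elim (use assms in auto)
    show "{\<omega> \<in> space M. H u \<omega> \<le> t} \<in> sets (completion M)" by (rule sets_completionI_sets) measurable
  qed
  also have "\<dots> = emeasure M {\<omega> \<in> space M. H u \<omega> \<le> t}" by simp
  also have "\<dots> \<le> ennreal (exp (\<xi> * t - u * \<xi> powr \<nu>))"
    by (rule stable_subordinator_small_ball[OF H]) fact+
  finally show ?thesis .
qed

text \<open>
  Slicing at integer levels bounds \<open>exp (k L)\<close> by a series whose terms are controlled by the tail bound.
  The resulting geometric series has ratio \<open>exp (k - \<xi> powr \<nu>)\<close>, and converges because
  \<open>k < \<xi> powr \<nu>\<close>.
\<close>

lemma inverse_subordinator_mgf_upper: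
  assumes k: "0 \<le> k" "k < \<xi> powr \<nu>" and "0 \<le> \<xi>"
  shows "\<exists>K. \<forall>t\<ge>0. mgf (completion M) (L t) k \<le> ennreal (K * exp (\<xi> * t))"
proof -
  define q where "q = exp (k - \<xi> powr \<nu>)"
  have q: "0 \<le> q" "q < 1" using k by (auto simp: q_def)
  define K where "K = exp k + exp (2 * k) / (1 - q)"
  have term_le: "f n \<le> suminf f" for f :: "nat \<Rightarrow> ennreal" and n
    using sum_le_suminf[of f "{n}"] by simp
  have "mgf (completion M) (L t) k \<le> ennreal (K * exp (\<xi> * t))" if t: "0 \<le> t" for t
  proof -
    have [measurable]: "L t \<in> borel_measurable (completion M)" by (rule L_meas[OF t])
    let ?E = "\<lambda>n. {\<omega> \<in> space (completion M). real n < L t \<omega>}"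
    have "mgf (completion M) (L t) k \<le> (\<integral>\<^sup>+\<omega>. ennreal (exp k) +
        (\<Sum>n. ennreal (exp (k * (real n + 2))) * indicator (?E n) \<omega>) \<partial>completion M)"
      unfolding mgf_def
    proof (rule nn_integral_mono)
      fix \<omega> assume \<omega>: "\<omega> \<in> space (completion M)"
      show "ennreal (exp (k * L t \<omega>)) \<le> ennreal (exp k) +
          (\<Sum>n. ennreal (exp (k * (real n + 2))) * indicator (?E n) \<omega>)"
      proof (cases "L t \<omega> \<le> 1")
        case True
        then have "k * L t \<omega> \<le> k" using mult_left_mono[of "L t \<omega>" 1 k] k by simp
        then show ?thesis by (intro add_increasing2) (auto intro: ennreal_leI)
      next
        case False
        \<comment> \<open>The integer with \<open>m + 1 < L t \<omega> \<le> m + 2\<close>.\<close>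
        define m where "m = nat (\<lceil>L t \<omega>\<rceil> - 2)"
        have "2 \<le> \<lceil>L t \<omega>\<rceil>" using False by linarith
        then have m: "real m = of_int \<lceil>L t \<omega>\<rceil> - 2" by (simp add: m_def)
        have "L t \<omega> \<le> real m + 2" "real m < L t \<omega>" unfolding m by linarith+
        then have "ennreal (exp (k * L t \<omega>)) \<le> ennreal (exp (k * (real m + 2))) * indicator (?E m) \<omega>"
          using \<omega> k by (auto intro!: ennreal_leI mult_left_mono)
        also have "\<dots> \<le> (\<Sum>n. ennreal (exp (k * (real n + 2))) * indicator (?E n) \<omega>)"
          by (rule term_le[of "\<lambda>n. ennreal (exp (k * (real n + 2))) * indicator (?E n) \<omega>" m])
        finally show ?thesis by (intro add_increasing) auto
      qed
    qed
    also have "\<dots> = ennreal (exp k) + (\<Sum>n. ennreal (exp (k * (real n + 2))) * emeasure (completion M) (?E n))"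
      by (subst nn_integral_add) (simp_all add: nn_integral_suminf nn_integral_cmult_indicator
          completion.emeasure_space_1 del: emeasure_completion space_completion)
    also have "\<dots> \<le> ennreal (exp k) + (\<Sum>n. ennreal (exp (2 * k) * exp (\<xi> * t) * q ^ n))"
    proof (intro add_left_mono suminf_le)
      fix n
      have "ennreal (exp (k * (real n + 2))) * emeasure (completion M) (?E n)
          \<le> ennreal (exp (k * (real n + 2))) * ennreal (exp (\<xi> * t - real n * \<xi> powr \<nu>))"
        using inverse_subordinator_tail[OF t, of "real n" \<xi>] \<open>0 \<le> \<xi>\<close> by (intro mult_left_mono) auto
      also have "\<dots> = ennreal (exp (2 * k) * exp (\<xi> * t) * q ^ n)"
        by (simp add: ennreal_mult[symmetric] exp_add[symmetric] q_def exp_of_nat_mult[symmetric] algebra_simps)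
      finally show "ennreal (exp (k * (real n + 2))) * emeasure (completion M) (?E n) \<le> \<dots>" .
    qed auto
    also have "(\<Sum>n. ennreal (exp (2 * k) * exp (\<xi> * t) * q ^ n)) = ennreal (exp (2 * k) * exp (\<xi> * t) * (1 / (1 - q)))"
      using q by (intro suminf_ennreal_eq sums_mult geometric_sums) auto
    also have "ennreal (exp k) + \<dots> = ennreal (exp k + exp (2 * k) * exp (\<xi> * t) * (1 / (1 - q)))"
      using q by (intro ennreal_plus[symmetric]) auto
    also have "\<dots> \<le> ennreal (K * exp (\<xi> * t))"
    proof (rule ennreal_leI)
      have "exp k * 1 \<le> exp k * exp (\<xi> * t)" using t \<open>0 \<le> \<xi>\<close> by (intro mult_left_mono) auto
      then show "exp k + exp (2 * k) * exp (\<xi> * t) * (1 / (1 - q)) \<le> K * exp (\<xi> * t)"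
        by (simp add: K_def distrib_right)
    qed
    finally show ?thesis .
  qed
  then show ?thesis by blast
qed

text \<open>
  By duality, \<open>E exp (k L t) \<ge> exp (k a t) P (H (a t) \<le> t)\<close>.  The Laplace transform of \<open>H (a t)\<close> gives
  \<open>- H (a t)\<close> the growth rate \<open>- a \<theta> powr \<nu>\<close> at \<open>\<theta> > 0\<close>; its slope at \<open>\<xi> = k powr (1 / \<nu>)\<close> is \<open>- x\<close>
  for the \<open>a\<close> chosen below, so the probability that \<open>H (a t) / t\<close> is near \<open>x < 1\<close> decays at a rate of at
  most \<open>a \<xi> powr \<nu> - \<xi> x\<close>.  As \<open>\<xi> powr \<nu> = k\<close>, the terms in \<open>a\<close> cancel and the rate \<open>\<xi> x\<close> remains, which
  exceeds \<open>c\<close> for \<open>x\<close> close to \<open>1\<close>.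
\<close>

lemma inverse_subordinator_mgf_lower_pos:
  assumes k: "0 < k" and c: "c < k powr (1 / \<nu>)"
  shows "\<forall>\<^sub>F t in at_top. ennreal (exp (c * t)) \<le> mgf (completion M) (L t) k"
proof -
  define \<xi> where "\<xi> = k powr (1 / \<nu>)"
  have \<xi>: "0 < \<xi>" "\<xi> powr \<nu> = k" using k \<nu> by (auto simp: \<xi>_def powr_powr)
  \<comment> \<open>Strictly between \<open>c / \<xi>\<close> and \<open>1\<close>, and positive even if \<open>c\<close> is not.\<close>
  define x where "x = max (1 / 2) ((c / \<xi> + 1) / 2)"
  have x: "0 < x" "x < 1" "c < \<xi> * x"
  proof -
    have "c / \<xi> < 1" using c \<xi> by (simp add: \<xi>_def)
    then show "0 < x" "x < 1" by (auto simp: x_def)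
    have "z < max (1 / 2) ((z + 1) / 2)" if "z < 1" for z :: real using that by (simp add: less_max_iff_disj)
    from this[OF \<open>c / \<xi> < 1\<close>] have "c / \<xi> < x" unfolding x_def .
    then show "c < \<xi> * x" using \<xi> by (simp add: field_simps)
  qed
  define a where "a = x * \<xi> powr (1 - \<nu>) / \<nu>"
  have a: "0 < a" using x \<xi> \<nu> by (simp add: a_def)
  have slope: "a * \<nu> * \<xi> powr (\<nu> - 1) = x"
    using \<nu> \<xi> by (simp add: a_def powr_add[symmetric])
  have "\<forall>\<^sub>F t in at_top. ennreal (exp ((c - k * a) * t)) \<le>
      emeasure M {\<omega> \<in> space M. - H (a * t) \<omega> / t \<in> {-1<..}}"
  proof (rule exp_growth_slope_lower_bound[where \<Lambda> = "\<lambda>\<theta>. - a * \<theta> powr \<nu>" and \<eta> = \<xi> and x = "- x"])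
    show "prob_space M" by (fact prob)
    show "(\<lambda>\<omega>. - H (a * t) \<omega>) \<in> borel_measurable M" if "0 < t" for t
      using H_meas[of "a * t"] a that by simp
    show "((\<lambda>\<theta>. - a * \<theta> powr \<nu>) has_real_derivative - x) (at \<xi>)"
      using \<xi> slope by (auto intro!: derivative_eq_intros simp: algebra_simps)
    have "\<forall>\<^sub>F \<theta> in nhds \<xi>. \<theta> \<in> {0<..}" using \<xi> by (intro eventually_nhds_in_open) auto
    then show "\<forall>\<^sub>F \<theta> in nhds \<xi>. has_exp_growth (\<lambda>t. mgf M (\<lambda>\<omega>. - H (a * t) \<omega>) \<theta>) (- a * \<theta> powr \<nu>)"
    proof eventually_elim
      case (elim \<theta>)
      show ?case
      proof (rule has_exp_growth_cong[OF has_exp_growth_exp])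
        fix t :: real assume "0 < t"
        have "mgf M (\<lambda>\<omega>. - H (a * t) \<omega>) \<theta> = mgf M (H (a * t)) (- \<theta>)" by (simp add: mgf_def)
        also have "\<dots> = ennreal (exp (- a * \<theta> powr \<nu> * t))"
          using stable_subordinator_mgf[OF H, of "a * t" \<theta>] a elim \<open>0 < t\<close> by (simp add: algebra_simps)
        finally show "mgf M (\<lambda>\<omega>. - H (a * t) \<omega>) \<theta> = ennreal (exp (- a * \<theta> powr \<nu> * t))" .
      qed
    qed
    show "open {- 1 :: real<..}" by simp
    show "- x \<in> {- 1<..}" using x by simp
    show "c - k * a < - a * \<xi> powr \<nu> - \<xi> * - x" using x \<xi> by simp
  qed
  then show ?thesis using eventually_gt_at_top[of 0]
  proof eventually_elim
    case (elim t)
    have [measurable]: "L t \<in> borel_measurable (completion M)" using L_meas elim by simp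
    have [measurable]: "H (a * t) \<in> borel_measurable M" using H_meas a elim by simp
    let ?E = "{\<omega> \<in> space M. - H (a * t) \<omega> / t \<in> {-1<..}}"
    have E [measurable]: "?E \<in> sets M" by measurable
    have "ennreal (exp (c * t)) = ennreal (exp (k * (a * t))) * ennreal (exp ((c - k * a) * t))"
      by (simp add: ennreal_mult[symmetric] exp_add[symmetric] algebra_simps)
    also have "\<dots> \<le> ennreal (exp (k * (a * t))) * emeasure M ?E"
      using elim by (intro mult_left_mono) auto
    also have "\<dots> = ennreal (exp (k * (a * t))) * emeasure (completion M) ?E" using E by simp
    also have "\<dots> = (\<integral>\<^sup>+\<omega>. ennreal (exp (k * (a * t))) * indicator ?E \<omega> \<partial>completion M)"
      by (rule nn_integral_cmult_indicator[symmetric]) (rule sets_completionI_sets[OF E])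
    also have "\<dots> \<le> mgf (completion M) (L t) k"
      unfolding mgf_def
    proof (rule nn_integral_mono_AE)
      show "AE \<omega> in completion M. ennreal (exp (k * (a * t))) * indicator ?E \<omega> \<le> ennreal (exp (k * L t \<omega>))"
        using AE_completion[OF first_passage_duality[OF H L less_imp_le[OF elim(2)]]]
      proof eventually_elim
        case (elim \<omega>)
        show ?case
        proof (cases "\<omega> \<in> ?E")
          case True
          then have "H (a * t) \<omega> \<le> t" using \<open>0 < t\<close> by (simp add: field_simps)
          then have "a * t \<le> L t \<omega>" using elim a \<open>0 < t\<close> by simp
          then show ?thesis using True k by (auto intro!: ennreal_leI)
        qed simp
      qed
    qed
    finally show ?case .
  qed
qed

text \<open>
  It suffices that \<open>L t \<le> \<epsilon> t\<close> with probability at least \<open>1 / 2\<close> for large \<open>t\<close>, where \<open>\<epsilon>\<close> is so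
  small that \<open>k \<epsilon>\<close> is well above \<open>c\<close>.  The tail bound at \<open>u = \<epsilon> t\<close> is exponentially small if
  \<open>\<xi> < \<epsilon> \<xi> powr \<nu>\<close>, which holds for small \<open>\<xi>\<close> because \<open>\<nu> < 1\<close>.
\<close>

lemma inverse_subordinator_mgf_lower_nonpos:
  assumes k: "k \<le> 0" and c: "c < 0"
  shows "\<forall>\<^sub>F t in at_top. ennreal (exp (c * t)) \<le> mgf (completion M) (L t) k"
proof -
  define \<epsilon> where "\<epsilon> = - c / (2 * (1 - k))"
  have \<epsilon>: "0 < \<epsilon>" "c / 2 \<le> k * \<epsilon>" using k c by (auto simp: \<epsilon>_def field_simps)
  \<comment> \<open>This \<open>\<xi>\<close> solves \<open>\<xi> = \<epsilon> / 2 * \<xi> powr \<nu>\<close>.\<close>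
  define \<xi> where "\<xi> = (\<epsilon> / 2) powr (1 / (1 - \<nu>))"
  have "0 < \<xi>" using \<epsilon> by (simp add: \<xi>_def)
  have "\<xi> = \<xi> powr (1 - \<nu>) * \<xi> powr \<nu>" using \<open>0 < \<xi>\<close> by (simp add: powr_add[symmetric])
  also have "\<xi> powr (1 - \<nu>) = \<epsilon> / 2" using \<nu> \<epsilon> by (simp add: \<xi>_def powr_powr)
  finally have \<xi>_eq: "\<xi> = \<epsilon> / 2 * \<xi> powr \<nu>" .
  have "0 < \<xi> powr \<nu>" using \<open>0 < \<xi>\<close> by simp
  have gap: "\<xi> - \<epsilon> * \<xi> powr \<nu> = - \<xi>" using \<xi>_eq by simp
  have "\<forall>\<^sub>F t in at_top. 2 \<le> exp (\<xi> * t)" using \<open>0 < \<xi>\<close> by (rule eventually_exp_ge)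
  moreover have "\<forall>\<^sub>F t in at_top. 2 \<le> exp (- c / 2 * t)" using c by (intro eventually_exp_ge) simp
  ultimately show ?thesis using eventually_gt_at_top[of 0]
  proof eventually_elim
    case (elim t)
    have [measurable]: "L t \<in> borel_measurable (completion M)" using L_meas elim by simp
    let ?E = "{\<omega> \<in> space (completion M). \<epsilon> * t < L t \<omega>}"
    let ?F = "{\<omega> \<in> space (completion M). L t \<omega> \<le> \<epsilon> * t}"
    have "emeasure (completion M) ?E \<le> ennreal (exp (\<xi> * t - \<epsilon> * t * \<xi> powr \<nu>))"
      using inverse_subordinator_tail[of t "\<epsilon> * t" \<xi>] elim \<epsilon> \<open>0 < \<xi>\<close> by simp
    also have "\<xi> * t - \<epsilon> * t * \<xi> powr \<nu> = (\<xi> - \<epsilon> * \<xi> powr \<nu>) * t" by (simp add: algebra_simps)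
    also have "\<dots> = - (\<xi> * t)" unfolding gap by simp
    also have "ennreal (exp (- (\<xi> * t))) \<le> ennreal (1 / 2)"
      using elim(1) by (intro ennreal_leI) (simp add: exp_minus field_simps)
    finally have "completion.prob ?E \<le> 1 / 2"
      unfolding completion.emeasure_eq_measure by (rule iffD1[OF ennreal_le_iff, rotated]) simp
    moreover have "completion.prob ?F = 1 - completion.prob ?E"
    proof -
      have "?F = space (completion M) - ?E" by auto
      then show ?thesis by (simp only:) (rule completion.prob_compl, measurable)
    qed
    ultimately have F: "1 / 2 \<le> completion.prob ?F" by simp
    have "exp (c * t) \<le> exp (c / 2 * t) * (1 / 2)"
    proof -
      have "2 * exp (c * t) \<le> exp (- c / 2 * t) * exp (c * t)" using elim(2) by (intro mult_right_mono) auto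
      also have "\<dots> = exp (c / 2 * t)" by (simp add: exp_add[symmetric])
      finally show ?thesis by simp
    qed
    also have "\<dots> \<le> exp (k * (\<epsilon> * t)) * completion.prob ?F"
      using mult_right_mono[OF \<epsilon>(2), of t] elim F by (intro mult_mono) (auto simp: algebra_simps)
    finally have "ennreal (exp (c * t)) \<le> ennreal (exp (k * (\<epsilon> * t))) * emeasure (completion M) ?F"
      unfolding completion.emeasure_eq_measure by (simp add: ennreal_mult[symmetric] ennreal_leI)
    also have "\<dots> = (\<integral>\<^sup>+\<omega>. ennreal (exp (k * (\<epsilon> * t))) * indicator ?F \<omega> \<partial>completion M)"
      by (rule nn_integral_cmult_indicator[symmetric]) measurable
    also have "\<dots> \<le> mgf (completion M) (L t) k"
      unfolding mgf_def
      by (intro nn_integral_mono) (use k in \<open>auto simp: indicator_def intro!: ennreal_leI mult_left_mono_neg\<close>)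
    finally show ?case .
  qed
qed

lemma inverse_subordinator_mgf_growth:
  "has_exp_growth (\<lambda>t. mgf (completion M) (L t) k) (if 0 \<le> k then k powr (1 / \<nu>) else 0)"
proof (cases "0 < k")
  case True
  have "\<forall>\<^sub>F t in at_top. mgf (completion M) (L t) k \<le> ennreal (exp (c * t))"
    if c: "k powr (1 / \<nu>) < c" for c
  proof -
    obtain \<xi> where \<xi>: "k powr (1 / \<nu>) < \<xi>" "\<xi> < c" using dense[OF c] by blast
    have "0 \<le> \<xi>" using powr_ge_zero[of k "1 / \<nu>"] \<xi>(1) by (rule order.trans[OF _ less_imp_le])
    have "k = (k powr (1 / \<nu>)) powr \<nu>" using True \<nu> by (simp add: powr_powr)
    also have "\<dots> < \<xi> powr \<nu>" using \<xi> \<nu> by (intro powr_less_mono2) auto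
    finally obtain K where K: "\<And>t. 0 \<le> t \<Longrightarrow> mgf (completion M) (L t) k \<le> ennreal (K * exp (\<xi> * t))"
      using inverse_subordinator_mgf_upper[of k \<xi>] True \<open>0 \<le> \<xi>\<close> by auto
    have "\<forall>\<^sub>F t in at_top. K \<le> exp ((c - \<xi>) * t)" using \<xi> by (intro eventually_exp_ge) simp
    then show ?thesis using eventually_gt_at_top[of 0]
    proof eventually_elim
      case (elim t)
      have "K * exp (\<xi> * t) \<le> exp ((c - \<xi>) * t) * exp (\<xi> * t)" using elim by (intro mult_right_mono) auto
      also have "\<dots> = exp (c * t)" by (simp add: exp_add[symmetric] algebra_simps)
      finally show ?case using K[of t] elim by (meson ennreal_leI less_imp_le order.trans)
    qed
  qed
  then show ?thesis using inverse_subordinator_mgf_lower_pos[OF True] True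
    by (simp add: has_exp_growth_def)
next
  case False
  have "\<forall>\<^sub>F t in at_top. mgf (completion M) (L t) k \<le> ennreal (exp (c * t))" if "0 < c" for c
    using eventually_gt_at_top[of 0]
  proof eventually_elim
    case (elim t)
    have "mgf (completion M) (L t) k \<le> (\<integral>\<^sup>+\<omega>. 1 \<partial>completion M)"
      unfolding mgf_def
    proof (rule nn_integral_mono_AE)
      show "AE \<omega> in completion M. ennreal (exp (k * L t \<omega>)) \<le> 1"
        using AE_completion[OF first_passage_duality[OF H L less_imp_le[OF elim]]]
        by eventually_elim (use False in \<open>auto simp: mult_nonpos_nonneg\<close>)
    qed
    also have "\<dots> = 1" using completion.emeasure_space_1 by (simp del: emeasure_completion)
    also have "1 \<le> ennreal (exp (c * t))" using elim that by (simp add: ennreal_1[symmetric] del: ennreal_1)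
    finally show ?case .
  qed
  then show ?thesis using inverse_subordinator_mgf_lower_nonpos[of k] False
    by (auto simp: has_exp_growth_def)
qed

end

section \<open>The time-changed process\<close>

theorem proposition3p1:
  fixes M :: "'a measure" and S L :: "real \<Rightarrow> 'a \<Rightarrow> real" and \<nu> :: real
    and \<kappa> \<Lambda> :: "real \<Rightarrow> ereal"
  defines "\<kappa> \<equiv> log_mgf M (S 1)"
  defines "\<Lambda> \<equiv> Lambda_fun \<nu> \<kappa>"
  assumes "prob_space M"
    and "0 < \<nu>" and "\<nu> < 1"
    and "levy_process M S"
    and "\<exists>\<delta>>0. \<forall>\<theta>. \<bar>\<theta>\<bar> < \<delta> \<longrightarrow> \<kappa> \<theta> < \<infinity>"
    and "inverse_stable_subordinator M \<nu> L"
    and "indep_processes (completion M) S L"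
    and "essentially_smooth \<Lambda>"
  shows "satisfies_LDP (completion M) (\<lambda>t \<omega>. S (L t \<omega>) \<omega> / t) (\<lambda>t. t) (legendre_transform \<Lambda>)
       \<and> good_rate_function (legendre_transform \<Lambda>)"
proof -
  interpret prob_space M by fact
  interpret completion: prob_space "completion M" by (rule prob_space_completion)
  have S1: "S 1 \<in> borel_measurable M" using \<open>levy_process M S\<close> by (simp add: levy_process_def)
  have cadlag: "AE \<omega> in M. cadlag (\<lambda>t. S t \<omega>)" using \<open>levy_process M S\<close> by (simp add: levy_process_def)
  obtain H where H: "stable_subordinator M \<nu> H"
    and L: "AE \<omega> in M. \<forall>t\<ge>0. L t \<omega> = Inf {u. 0 \<le> u \<and> H u \<omega> > t}"
    using \<open>inverse_stable_subordinator M \<nu> L\<close> unfolding inverse_stable_subordinator_def by blast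
  have S_path: "(\<lambda>\<omega>. \<lambda>t\<in>{0..}. S t \<omega>) \<in> completion M \<rightarrow>\<^sub>M Pi\<^sub>M {0..} (\<lambda>_. borel)"
    and L_path: "(\<lambda>\<omega>. \<lambda>t\<in>{0..}. L t \<omega>) \<in> completion M \<rightarrow>\<^sub>M Pi\<^sub>M {0..} (\<lambda>_. borel)"
    using \<open>indep_processes (completion M) S L\<close>
    unfolding indep_processes_def completion.indep_var_distribution_eq by auto
  have L_meas: "L t \<in> borel_measurable (completion M)" if "0 \<le> t" for t
    using measurable_compose[OF L_path measurable_component_singleton[of t "{0..}"]] that by simp
  have L_nonneg: "AE \<omega> in M. 0 \<le> L t \<omega>" if "0 \<le> t" for t
    using first_passage_duality[OF H L that] by eventually_elim simp
  have \<kappa>_mgf: "\<kappa> \<theta> = ln_ennreal (mgf M (S 1) \<theta>)" for \<theta> by (simp add: \<kappa>_def log_mgf_eq_mgf)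
  have \<Lambda>_nonneg: "0 \<le> \<Lambda> \<theta>" for \<theta> unfolding \<Lambda>_def by (rule Lambda_fun_nonneg)
  have "mgf M (S 1) 0 = 1" by (simp add: mgf_def emeasure_space_1)
  then have \<Lambda>_0: "\<Lambda> 0 = 0" by (simp add: \<Lambda>_def Lambda_fun_def \<kappa>_mgf ln_ennreal_def zero_ereal_def)
  have star: "\<Lambda> (p * \<theta>) \<le> \<Lambda> \<theta>" if "0 \<le> p" "p \<le> 1" for \<theta> p
    unfolding \<Lambda>_def \<kappa>_def by (rule Lambda_fun_log_mgf_contraction) fact+
  have D_iff: "\<theta> \<in> eff_domain \<Lambda> \<longleftrightarrow> \<kappa> \<theta> < \<infinity>" for \<theta>
    by (auto simp: eff_domain_def \<Lambda>_def Lambda_fun_def)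
  have int0: "0 \<in> interior (eff_domain \<Lambda>)"
  proof -
    obtain \<delta> where "\<delta> > 0" "\<And>\<theta>. \<bar>\<theta>\<bar> < \<delta> \<Longrightarrow> \<kappa> \<theta> < \<infinity>" using assms(7) by blast
    then have "ball 0 \<delta> \<subseteq> eff_domain \<Lambda>" by (auto simp: D_iff)
    then show ?thesis using \<open>\<delta> > 0\<close> mem_interior by blast
  qed
  have growth: "has_exp_growth (\<lambda>t. mgf (completion M) (\<lambda>\<omega>. S (L t \<omega>) \<omega>) \<theta>) (real_of_ereal (\<Lambda> \<theta>))"
    if \<theta>: "\<theta> \<in> eff_domain \<Lambda>" for \<theta>
  proof -
    have "\<kappa> \<theta> \<noteq> -\<infinity>"
    proof
      assume "\<kappa> \<theta> = -\<infinity>"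
      then have "mgf M (S 1) \<theta> = 0" by (simp add: \<kappa>_mgf ln_ennreal_def split: if_splits)
      then have "AE \<omega> in M. False"
        unfolding mgf_def using S1 by (subst (asm) nn_integral_0_iff_AE) auto
      then show False by simp
    qed
    then obtain k where k: "\<kappa> \<theta> = ereal k" using \<theta> by (cases "\<kappa> \<theta>") (auto simp: D_iff)
    then have mgf1: "mgf M (S 1) \<theta> = ennreal (exp k)"
      by (simp add: \<kappa>_mgf ln_ennreal_eq_ereal_iff)
    have mgf_eq: "mgf (completion M) (\<lambda>\<omega>. S (L t \<omega>) \<omega>) \<theta> = mgf (completion M) (L t) k" if "0 < t" for t
    proof -
      have "mgf (completion M) (\<lambda>\<omega>. S (L t \<omega>) \<omega>) \<theta>
          = (\<integral>\<^sup>+\<omega>. (\<integral>\<^sup>+\<omega>'. ennreal (exp (\<theta> * S (L t \<omega>) \<omega>')) \<partial>completion M) \<partial>completion M)"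
        unfolding mgf_def
        by (rule nn_integral_process_at_independent_time[OF completion.prob_space_axioms
              \<open>indep_processes (completion M) S L\<close> less_imp_le[OF that] AE_completion[OF cadlag]
              AE_completion[OF L_nonneg[OF less_imp_le[OF that]]]]) measurable
      also have "\<dots> = (\<integral>\<^sup>+\<omega>. ennreal (exp (k * L t \<omega>)) \<partial>completion M)"
        using AE_completion[OF L_nonneg[OF less_imp_le[OF that]]]
      proof (intro nn_integral_cong_AE, eventually_elim)
        case (elim \<omega>)
        then show ?case
          using levy_mgf[OF \<open>levy_process M S\<close> mgf1 elim(2)] by (simp add: mgf_def nn_integral_completion)
      qed
      finally show ?thesis by (simp add: mgf_def)
    qed
    have rate: "real_of_ereal (\<Lambda> \<theta>) = (if 0 \<le> k then k powr (1 / \<nu>) else 0)"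
      by (simp add: \<Lambda>_def Lambda_fun_def k)
    have "has_exp_growth (\<lambda>t. mgf (completion M) (L t) k) (if 0 \<le> k then k powr (1 / \<nu>) else 0)"
      by (rule inverse_subordinator_mgf_growth[OF \<open>prob_space M\<close> \<open>0 < \<nu>\<close> \<open>\<nu> < 1\<close> H L L_meas])
    then show ?thesis unfolding rate using mgf_eq by (rule has_exp_growth_cong)
  qed
  have meas: "(\<lambda>\<omega>. S (L t \<omega>) \<omega>) \<in> borel_measurable (completion M)" if "0 < t" for t
    by (rule measurable_process_at_random_time[OF S_path L_meas[OF less_imp_le[OF that]] cadlag
          L_nonneg[OF less_imp_le[OF that]]])
  have "satisfies_LDP (completion M) (\<lambda>t \<omega>. S (L t \<omega>) \<omega> / t) (\<lambda>t. t) (legendre_transform \<Lambda>)"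
    by (rule gaertner_ellis_nonneg[OF completion.prob_space_axioms meas \<open>essentially_smooth \<Lambda>\<close>
          \<Lambda>_nonneg \<Lambda>_0 star int0 growth])
  moreover have "good_rate_function (legendre_transform \<Lambda>)"
    by (rule good_rate_function_legendre[OF \<Lambda>_nonneg int0])
  ultimately show ?thesis ..
qed

end
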